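(* Let $n\ge3$ and let $\mathcal{M}$ be the Markov operator of the edge lamplighter random walk on the discrete circle $C_n$, acting on the $n2^n$-dimensional space $L(\{0,1\}^{E_n}\times C_n)$. The set of eigenvalues of $\mathcal{M}$ is \[ \{1\}\cup\{0\}\cup\Big\{\cos\tfrac{h\pi}{k}:3\le k\le n+1,\ 1\le h\le k-1,\ (h,k)=1\Big\} \] when $n$ is odd, and \[ \{1\}\cup\{0\}\cup\{-1\}\cup\Big\{\cos\tfrac{h\pi}{k}:3\le k\le n+1,\ 1\le h\le k-1,\ (h,k)=1\Big\} \] when $n$ is even. Moreover the multiplicities of the eigenvalues are the following. 1. Suppose $3\le k\le n+1$, $1\le h\le k-1$, $(h,k)=1$ and $n+1=kq+r$ with $0\le r\le k-1$. Then the multiplicity of the eigenvalue $\cos\frac{h\pi}{k}$ equals - $n\frac{2^n-2^{r-1}}{2^k-1}$ when $r\ne0,1$; - $n\frac{2^n-1}{2^k-1}$ when $r=1$ and $hq$ is odd; - $n\frac{2^n-1}{2^k-1}+2$ when $r=1$ and $hq$ is even; - $n\frac{2^n+2^{k-1}-1}{2^k-1}$ when $r=0$. 2. The multiplicity of $1$ is always equal to $1$; the multiplicity of $-1$ is $1$ when $n$ is even and $0$ when $n$ is odd. 3. The multiplicity of $0$ equals - $\frac n3 2^n+\frac n3$ if $n$ is odd; - $\frac n3 2^n-\frac n3$ if $n\equiv2 \pmod 4$; - $\frac n3 2^n-\frac n3+2$ if $n\equiv0\pmod 4$.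
   Context: $C_n$ is the graph with vertex set $\{0,1,\dots,n-1\}$ and edge set $E_n=\{\{0,1\},\{1,2\},\dots,\{n-2,n-1\},\{n-1,0\}\}$; $x\sim y$ means $\{x,y\}\in E_n$. $(h,k)$ denotes the greatest common divisor. For a finite set $Y$, $L(Y)$ is the space of complex functions on $Y$. The edge lamplighter random walk on $C_n$ is the simple random walk on the graph with vertex set $\{0,1\}^{E_n}\times C_n$ in which $(\omega,x)$ and $(\theta,y)$ are adjacent iff $x\sim y$ and $\omega(e)=\theta(e)$ for all edges $e\neq\{x,y\}$. Its Markov operator is \[ (\mathcal{M}\Phi)(\omega,x)=\frac14\sum_{y\sim x}\big[\Phi(\omega,y)+\Phi(\omega+\delta_{\{x,y\}},y)\big], \] where addition in $\{0,1\}^{E_n}$ is pointwise mod $2$ and $\delta_e$ equals $1$ at $e$ and $0$ elsewhere. The multiplicity of an eigenvalue is the dimension of its eigenspace. *)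

theory Defs
  imports
    Complex_Main
    "HOL-Library.FuncSet"
    "HOL-Library.Function_Algebras"
    "HOL-Library.Indicator_Function"
    "HOL-Library.Z2"
begin

section \<open>Complex functions on a finite set, eigenvalues and multiplicities\<close>

definition fun_scale :: "complex \<Rightarrow> ('a \<Rightarrow> complex) \<Rightarrow> 'a \<Rightarrow> complex" where
  "fun_scale c f = (\<lambda>x. c * f x)"

global_interpretation cfun: vector_space fun_scale
  by unfold_locales (auto simp: fun_scale_def fun_eq_iff algebra_simps)

text \<open>A function on \<open>Y\<close> is represented by its extension by zero to the whole type, so that
  \<open>L Y\<close> is a subspace.\<close>

definition L :: "'a set \<Rightarrow> ('a \<Rightarrow> complex) set" where
  "L Y = {f. \<forall>x. x \<notin> Y \<longrightarrow> f x = 0}"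

definition eigenspace ::
  "('a \<Rightarrow> complex) set \<Rightarrow> (('a \<Rightarrow> complex) \<Rightarrow> ('a \<Rightarrow> complex)) \<Rightarrow> complex \<Rightarrow> ('a \<Rightarrow> complex) set"
  where "eigenspace S T c = {f \<in> S. T f = fun_scale c f}"

definition eigenvalues ::
  "('a \<Rightarrow> complex) set \<Rightarrow> (('a \<Rightarrow> complex) \<Rightarrow> ('a \<Rightarrow> complex)) \<Rightarrow> complex set"
  where "eigenvalues S T = {c. \<exists>f \<in> S. f \<noteq> 0 \<and> T f = fun_scale c f}"

definition multiplicity_of ::
  "('a \<Rightarrow> complex) set \<Rightarrow> (('a \<Rightarrow> complex) \<Rightarrow> ('a \<Rightarrow> complex)) \<Rightarrow> complex \<Rightarrow> nat"
  where "multiplicity_of S T c = cfun.dim (eigenspace S T c)"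

section \<open>The edge lamplighter walk on the discrete circle\<close>

definition circle_edges :: "nat \<Rightarrow> nat set set" where
  "circle_edges n = {{i, i + 1} | i. i + 1 < n} \<union> {{n - 1, 0}}"

definition circle_adj :: "nat \<Rightarrow> nat \<Rightarrow> nat \<Rightarrow> bool" where
  "circle_adj n x y \<longleftrightarrow> {x, y} \<in> circle_edges n"

text \<open>The two-element field \<^typ>\<open>bit\<close> plays the role of \<open>{0,1}\<close>, so that addition of
  configurations is pointwise addition mod 2. Configurations are extensional functions on the
  edge set; adding the indicator of an edge of the circle does not change the values off the
  edge set.\<close>

type_synonym lamp_state = "(nat set \<Rightarrow> bit) \<times> nat"

definition lamp_states :: "nat \<Rightarrow> lamp_state set" where
  "lamp_states n = (circle_edges n \<rightarrow>\<^sub>E UNIV) \<times> {0..<n}"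

definition lamp_adj :: "nat \<Rightarrow> lamp_state \<Rightarrow> lamp_state \<Rightarrow> bool" where
  "lamp_adj n u v \<longleftrightarrow> u \<in> lamp_states n \<and> v \<in> lamp_states n \<and>
     circle_adj n (snd u) (snd v) \<and>
     (\<forall>e \<in> circle_edges n. e \<noteq> {snd u, snd v} \<longrightarrow> fst u e = fst v e)"

definition markov_op :: "nat \<Rightarrow> (lamp_state \<Rightarrow> complex) \<Rightarrow> (lamp_state \<Rightarrow> complex)" where
  "markov_op n \<Phi> = (\<lambda>(\<omega>, x).
     if (\<omega>, x) \<in> lamp_states n
     then 1 / 4 * (\<Sum>y | circle_adj n x y. \<Phi> (\<omega>, y) + \<Phi> (\<omega> + indicator {{x, y}}, y))
     else 0)"

lemma circle_adj_less: "n \<ge> 1 \<Longrightarrow> circle_adj n x y \<Longrightarrow> x < n \<and> y < n"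
  by (auto simp: circle_adj_def circle_edges_def doubleton_eq_iff)

lemma circle_nbrs:
  assumes "n \<ge> 3" "x < n"
  shows "{y. circle_adj n x y} =
    {if x + 1 < n then x + 1 else 0, if x = 0 then n - 1 else x - 1}"
  using assms
  by (auto simp: circle_adj_def circle_edges_def doubleton_eq_iff split: if_splits) presburger+

lemma card_circle_nbrs:
  assumes "n \<ge> 3" "x < n"
  shows "card {y. circle_adj n x y} = 2"
  unfolding circle_nbrs[OF assms] using assms by (simp add: card_insert_if) auto

lemma lamp_states_iff: "(\<omega>, x) \<in> lamp_states n \<longleftrightarrow> \<omega> \<in> extensional (circle_edges n) \<and> x < n"
  by (auto simp: lamp_states_def PiE_def)

lemma markov_op_in_L: "markov_op n \<Phi> \<in> L (lamp_states n)"
  by (auto simp: markov_op_def L_def)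

lemma linear_markov_op: "Vector_Spaces.linear fun_scale fun_scale (markov_op n)"
proof -
  have 1: "markov_op n (\<Phi> + \<Psi>) = markov_op n \<Phi> + markov_op n \<Psi>" for \<Phi> \<Psi>
  proof (rule ext, clarify)
    fix \<omega> x
    show "markov_op n (\<Phi> + \<Psi>) (\<omega>, x) = (markov_op n \<Phi> + markov_op n \<Psi>) (\<omega>, x)"
      by (simp add: markov_op_def sum.distrib add_divide_distrib)
  qed
  have 2: "markov_op n (fun_scale c \<Phi>) = fun_scale c (markov_op n \<Phi>)" for c \<Phi>
  proof (rule ext, clarify)
    fix \<omega> x
    show "markov_op n (fun_scale c \<Phi>) (\<omega>, x) = fun_scale c (markov_op n \<Phi>) (\<omega>, x)"
      by (simp add: markov_op_def fun_scale_def flip: distrib_left sum_distrib_left)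
  qed
  show ?thesis
    unfolding Vector_Spaces.linear_iff by (simp add: 1 2 cfun.vector_space_axioms)
qed

lemma lamp_adj_iff:
  assumes n: "n \<ge> 1" and st: "(\<omega>, x) \<in> lamp_states n"
  shows "lamp_adj n (\<omega>, x) (\<theta>, y) \<longleftrightarrow>
    circle_adj n x y \<and> (\<theta> = \<omega> \<or> \<theta> = \<omega> + indicator {{x, y}})"
proof
  assume a: "lamp_adj n (\<omega>, x) (\<theta>, y)"
  have ex: "\<omega> \<in> extensional (circle_edges n)" "\<theta> \<in> extensional (circle_edges n)"
    using a by (auto simp: lamp_adj_def lamp_states_iff)
  have e: "\<theta> e = \<omega> e" if "e \<noteq> {x, y}" for e
    using a ex that by (cases "e \<in> circle_edges n") (auto simp: lamp_adj_def extensional_def)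
  have "\<theta> = \<omega> \<or> \<theta> = \<omega> + indicator {{x, y}}"
  proof (cases "\<theta> {x, y} = \<omega> {x, y}")
    case True
    then have "\<theta> = \<omega>" using e by (intro ext) metis
    then show ?thesis ..
  next
    case False
    then have *: "\<theta> {x, y} = \<omega> {x, y} + 1"
      by (cases "\<theta> {x, y}"; cases "\<omega> {x, y}") auto
    have "\<theta> e = (\<omega> + indicator {{x, y}}) e" for e
      using * e[of e] by (cases "e = {x, y}") simp_all
    then have "\<theta> = \<omega> + indicator {{x, y}}" by blast
    then show ?thesis ..
  qed
  then show "circle_adj n x y \<and> (\<theta> = \<omega> \<or> \<theta> = \<omega> + indicator {{x, y}})"
    using a by (auto simp: lamp_adj_def)
next
  assume a: "circle_adj n x y \<and> (\<theta> = \<omega> \<or> \<theta> = \<omega> + indicator {{x, y}})"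
  have y: "y < n" using circle_adj_less[OF n] a by blast
  have ed: "{x, y} \<in> circle_edges n" using a by (simp add: circle_adj_def)
  have "\<theta> \<in> extensional (circle_edges n)"
    using a ed st by (auto simp: lamp_states_iff extensional_def indicator_def)
  moreover have "\<omega> e = \<theta> e" if "e \<noteq> {x, y}" for e
  proof -
    have "indicator {{x, y}} e = (0 :: bit)" using that by (simp only: indicator_def) simp
    then show ?thesis using a by (elim conjE disjE) simp_all
  qed
  ultimately show "lamp_adj n (\<omega>, x) (\<theta>, y)"
    using a st y by (simp add: lamp_adj_def lamp_states_iff)
qed

lemma markov_op_simple_random_walk:
  assumes n: "n \<ge> 3" and u: "u \<in> lamp_states n"
  shows "card {v. lamp_adj n u v} = 4"
    and "markov_op n \<Phi> u = (\<Sum>v | lamp_adj n u v. \<Phi> v) / of_nat (card {v. lamp_adj n u v})"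
proof -
  obtain \<omega> x where ux: "u = (\<omega>, x)" by (cases u)
  have st: "(\<omega>, x) \<in> lamp_states n" and x: "x < n"
    using u ux by (auto simp: lamp_states_iff)
  define N where "N = {y. circle_adj n x y}"
  have N: "finite N" "card N = 2"
    unfolding N_def using card_circle_nbrs[OF n x] by (auto intro: card_ge_0_finite)
  have ne: "(indicator {{x, y}} :: nat set \<Rightarrow> bit) \<noteq> 0" for y
  proof
    assume "(indicator {{x, y}} :: nat set \<Rightarrow> bit) = 0"
    from fun_cong[OF this, of "{x, y}"] show False by simp
  qed
  let ?A = "\<lambda>y. {(\<omega>, y), (\<omega> + indicator {{x, y}}, y)}"
  have eq: "{v. lamp_adj n u v} = (\<Union>y\<in>N. ?A y)"
    using lamp_adj_iff[OF _ st] n by (auto simp: ux N_def)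
  have "(\<Sum>v | lamp_adj n u v. g v) = (\<Sum>y\<in>N. g (\<omega>, y) + g (\<omega> + indicator {{x, y}}, y))"
    for g :: "lamp_state \<Rightarrow> 'b::comm_monoid_add"
  proof -
    have "(\<Sum>v | lamp_adj n u v. g v) = (\<Sum>y\<in>N. sum g (?A y))"
      unfolding eq using N by (subst sum.UNION_disjoint) auto
    also have "\<dots> = (\<Sum>y\<in>N. g (\<omega>, y) + g (\<omega> + indicator {{x, y}}, y))"
      by (intro sum.cong refl) (simp add: ne)
    finally show ?thesis .
  qed
  note s = this
  show c: "card {v. lamp_adj n u v} = 4"
    using s[of "\<lambda>_. 1::nat"] N by simp
  show "markov_op n \<Phi> u = (\<Sum>v | lamp_adj n u v. \<Phi> v) / of_nat (card {v. lamp_adj n u v})"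
    unfolding c s using st by (simp add: markov_op_def ux N_def)
qed

end

(* Expanding in the characters of the lamp group splits the walk into the simple random walks,
   with killing, on the circle with a set theta of edges removed. For theta empty this is the
   circle, with eigenfunctions exp (2 pi i j x / n); otherwise it is a disjoint union of paths, and
   a path on m vertices has eigenfunctions sin (pi h t / (m + 1)) with eigenvalues
   cos (pi h / (m + 1)). These functions form an orthogonal eigenbasis, so a multiplicity is a
   count: cos (h pi / k) with (h, k) = 1 comes once from every path with k j - 1 vertices, and twice
   from the circle when 2 k divides h n. A path on m < n vertices arises in n 2^(n - m - 1) ways, one
   on n vertices in n ways, and the sum over j is geometric. *)

theory Submission
  imports Defs
begin

section \<open>Orthogonal eigenbases\<close>

text \<open>Completeness is not proved by expanding a function in the eigenfunctions. The family has
  exactly n * 2^n members, the dimension of the space, so orthogonality, which gives independence,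
  already makes it a basis; the price is the exact count in \<open>card_index\<close>. The sines on
  an arc satisfy the interior recurrence up to both ends because a removed edge contributes 0, which
  is the value of the sine one step beyond the arc. An arc on all n vertices arises from a single
  removed edge that serves as both ends. Its weight is therefore 1, where the pattern 2^(n - m - 1)
  would suggest 1/2, and this is why r = 0 has a formula of its own. Equality of eigenvalues is
  decided by cross-multiplying the fractions h/k, which reduces multiplicities to arithmetic on
  naturals. The value 0 is cos (pi/2), the case k = 2 of the same count.\<close>

definition hprod :: "'a set \<Rightarrow> ('a \<Rightarrow> complex) \<Rightarrow> ('a \<Rightarrow> complex) \<Rightarrow> complex" where
  "hprod Y f g = (\<Sum>u\<in>Y. f u * cnj (g u))"

lemma fun_sum_apply: "(\<Sum>i\<in>A. f i) x = (\<Sum>i\<in>A. f i x)"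
  by (induction A rule: infinite_finite_induct) auto

lemma hprod_add_left: "hprod Y (f + g) h = hprod Y f h + hprod Y g h"
  by (simp add: hprod_def algebra_simps sum.distrib)

lemma hprod_scale_left: "hprod Y (fun_scale c f) h = c * hprod Y f h"
  by (simp add: hprod_def fun_scale_def sum_distrib_left mult.assoc)

lemma hprod_zero_left: "hprod Y 0 h = 0"
  by (simp add: hprod_def)

lemma hprod_sum_left: "hprod Y (\<Sum>i\<in>A. f i) h = (\<Sum>i\<in>A. hprod Y (f i) h)"
  unfolding hprod_def fun_sum_apply sum_distrib_right by (rule sum.swap)

lemma hprod_commute_eq_0: "hprod Y f g = 0 \<longleftrightarrow> hprod Y g f = 0"
proof -
  have "hprod Y f g = cnj (hprod Y g f)"
    by (simp add: hprod_def cnj_sum mult.commute)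
  then show ?thesis by simp
qed

lemma hprod_self_eq_0:
  assumes "finite Y" "f \<in> L Y" "hprod Y f f = 0"
  shows "f = 0"
proof -
  have "hprod Y f f = of_real (\<Sum>u\<in>Y. (cmod (f u))\<^sup>2)"
    unfolding hprod_def by (simp only: of_real_sum complex_norm_square)
  then have "(\<Sum>u\<in>Y. (cmod (f u))\<^sup>2) = 0"
    using assms(3) of_real_eq_0_iff by metis
  then have "f u = 0" if "u \<in> Y" for u
    using that assms(1) by (simp add: sum_nonneg_eq_0_iff)
  then show ?thesis using assms(2) by (auto simp: L_def fun_eq_iff)
qed

text \<open>Since d is real, conjugation in the second slot leaves it unchanged, and
  self-adjointness turns into c * <f,g> = d * <f,g>.\<close>

lemma hprod_eq_0_if_eigenvalues_differ:
  fixes c d :: real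
  assumes "hprod Y (T f) g = hprod Y f (T g)"
    and "T f = fun_scale c f" "T g = fun_scale d g" "c \<noteq> d"
  shows "hprod Y f g = 0"
proof -
  have "hprod Y f (fun_scale d g) = d * hprod Y f g"
    by (simp add: hprod_def fun_scale_def sum_distrib_left algebra_simps)
  then have "c * hprod Y f g = d * hprod Y f g"
    using assms(1-3) by (simp add: hprod_scale_left)
  then show ?thesis using assms(4) by simp
qed

lemma subspace_L: "cfun.subspace (L Y)"
  by (auto simp: cfun.subspace_def L_def fun_scale_def)

text \<open>The vectors orthogonal to \<open>v i\<close> form a subspace containing all the others;
  a dependence would put \<open>v i\<close> itself into it.\<close>

lemma orthogonal_family_independent:
  assumes orth: "\<And>i j. i \<in> I \<Longrightarrow> j \<in> I \<Longrightarrow> i \<noteq> j \<Longrightarrow> hprod Y (v i) (v j) = 0"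
    and pos: "\<And>i. i \<in> I \<Longrightarrow> hprod Y (v i) (v i) \<noteq> 0"
  shows "inj_on v I" "cfun.independent (v ` I)"
proof -
  show "inj_on v I"
    using orth pos by (auto simp: inj_on_def) metis
  show "cfun.independent (v ` I)"
    unfolding cfun.dependent_def
  proof safe
    fix i assume i: "i \<in> I" and sp: "v i \<in> cfun.span (v ` I - {v i})"
    have "cfun.subspace {f. hprod Y f (v i) = 0}"
      by (auto simp: cfun.subspace_def hprod_add_left hprod_scale_left hprod_zero_left)
    moreover have "v ` I - {v i} \<subseteq> {f. hprod Y f (v i) = 0}"
      using i orth by auto
    ultimately have "v i \<in> {f. hprod Y f (v i) = 0}"
      using sp cfun.span_minimal by blast
    then show False using pos[OF i] by simp
  qed
qed

text \<open>Point masses form a basis. The second claim supplies a finite spanning set for the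
  exchange bound, since the ambient space of all functions on the type may be
  infinite-dimensional.\<close>

lemma dim_L:
  assumes "finite Y"
  shows "cfun.dim (L Y) = card Y"
    and "\<exists>B. finite B \<and> card B = card Y \<and> cfun.span B = L Y"
proof -
  define d where "d y = (\<lambda>x. if x = y then 1 else 0 :: complex)" for y :: 'a
  have d: "hprod Y (d i) (d j) = (if i = j then 1 else 0)" if "i \<in> Y" for i j
  proof -
    have "hprod Y (d i) (d j) = (\<Sum>u\<in>Y. if u = i then (if i = j then 1 else 0) else 0)"
      unfolding hprod_def d_def by (intro sum.cong) auto
    then show ?thesis using that assms by simp
  qed
  have ind: "inj_on d Y" "cfun.independent (d ` Y)"
    by (rule orthogonal_family_independent[of Y Y]; simp add: d)+
  have sub: "d ` Y \<subseteq> L Y" by (auto simp: d_def L_def)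
  have "f \<in> cfun.span (d ` Y)" if "f \<in> L Y" for f
  proof -
    have "f = (\<Sum>y\<in>Y. fun_scale (f y) (d y))"
    proof
      fix x
      have "(\<Sum>y\<in>Y. fun_scale (f y) (d y)) x = (\<Sum>y\<in>Y. if y = x then f y else 0)"
        unfolding fun_sum_apply fun_scale_def d_def by (intro sum.cong) auto
      then show "f x = (\<Sum>y\<in>Y. fun_scale (f y) (d y)) x"
        using that assms by (auto simp: L_def)
    qed
    also have "\<dots> \<in> cfun.span (d ` Y)"
      by (intro cfun.span_sum cfun.span_scale cfun.span_base) auto
    finally show ?thesis .
  qed
  then have sp: "L Y \<subseteq> cfun.span (d ` Y)" by auto
  show "cfun.dim (L Y) = card Y"
    using cfun.dim_unique[OF sub sp ind(2)] ind(1) by (simp add: card_image)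
  have "cfun.span (d ` Y) = L Y"
    using sp cfun.span_minimal[OF sub subspace_L] by auto
  then show "\<exists>B. finite B \<and> card B = card Y \<and> cfun.span B = L Y"
    using assms ind(1) by (intro exI[of _ "d ` Y"]) (auto simp: card_image)
qed

text \<open>As many orthogonal nonzero vectors as the dimension form a basis; in such an eigenbasis
  an eigenvector for c has nonzero coefficients only where \<open>lam i = c\<close>.\<close>

lemma orthogonal_eigenbasis:
  fixes v :: "'i \<Rightarrow> 'a \<Rightarrow> complex" and lam :: "'i \<Rightarrow> complex"
  assumes fin: "finite Y" "finite I" and card: "card I = card Y"
    and lin: "Vector_Spaces.linear fun_scale fun_scale T"
    and mem: "\<And>i. i \<in> I \<Longrightarrow> v i \<in> L Y"
    and nz: "\<And>i. i \<in> I \<Longrightarrow> v i \<noteq> 0"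
    and orth: "\<And>i j. i \<in> I \<Longrightarrow> j \<in> I \<Longrightarrow> i \<noteq> j \<Longrightarrow> hprod Y (v i) (v j) = 0"
    and eig: "\<And>i. i \<in> I \<Longrightarrow> T (v i) = fun_scale (lam i) (v i)"
  shows "multiplicity_of (L Y) T c = card {i \<in> I. lam i = c}"
    and "eigenvalues (L Y) T = lam ` I"
proof -
  interpret T: Vector_Spaces.linear fun_scale fun_scale T by fact
  have pos: "hprod Y (v i) (v i) \<noteq> 0" if "i \<in> I" for i
    using hprod_self_eq_0[OF fin(1) mem[OF that]] nz[OF that] by blast
  note ind = orthogonal_family_independent[of I Y v, OF orth pos]
  have sp: "f \<in> cfun.span (v ` I)" if f: "f \<in> L Y" for f
  proof (rule ccontr)
    \<comment> \<open>Adjoining f would give \<open>card Y + 1\<close> independent vectors in the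
      span of \<open>card Y\<close> vectors.\<close>
    assume nf: "f \<notin> cfun.span (v ` I)"
    obtain B where B: "finite B" "card B = card Y" "cfun.span B = L Y"
      using dim_L(2)[OF fin(1)] by blast
    have "cfun.independent (insert f (v ` I))"
      using nf ind(2) by (rule cfun.independent_insertI)
    moreover have "insert f (v ` I) \<subseteq> cfun.span B"
      using f mem B(3) by auto
    ultimately have "card (insert f (v ` I)) \<le> card B"
      using cfun.independent_span_bound[OF B(1)] by blast
    moreover have "f \<notin> v ` I" using nf cfun.span_base by blast
    then have "card (insert f (v ` I)) = Suc (card Y)"
      using fin ind(1) card by (simp add: card_image)
    ultimately show False using B(2) by simp
  qed
  have expand: "\<exists>a. f = (\<Sum>i\<in>I. fun_scale (a i) (v i))" if f: "f \<in> L Y" for f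
  proof -
    obtain u where "f = (\<Sum>w\<in>v ` I. fun_scale (u w) w)"
      using sp[OF f] cfun.span_finite[of "v ` I"] fin by auto
    then have "f = (\<Sum>i\<in>I. fun_scale (u (v i)) (v i))"
      using ind(1) by (simp add: sum.reindex)
    then show ?thesis by (rule exI[of _ "\<lambda>i. u (v i)"])
  qed
  have ex: "\<exists>a. f = (\<Sum>i\<in>I. fun_scale (a i) (v i)) \<and> (\<forall>i\<in>I. lam i \<noteq> c \<longrightarrow> a i = 0)"
    if f: "f \<in> L Y" "T f = fun_scale c f" for f c
  proof -
    obtain a where a: "f = (\<Sum>i\<in>I. fun_scale (a i) (v i))"
      using expand f(1) by blast
    have coeff: "hprod Y (\<Sum>i\<in>I. fun_scale (b i) (v i)) (v j) = b j * hprod Y (v j) (v j)"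
      if "j \<in> I" for b j
    proof -
      have "hprod Y (\<Sum>i\<in>I. fun_scale (b i) (v i)) (v j)
          = (\<Sum>i\<in>I. if i = j then b j * hprod Y (v j) (v j) else 0)"
        unfolding hprod_sum_left hprod_scale_left
        by (intro sum.cong refl) (use orth that in auto)
      then show ?thesis using that fin by simp
    qed
    have Tf: "T f = (\<Sum>i\<in>I. fun_scale (a i * lam i) (v i))"
      unfolding a T.sum by (intro sum.cong refl) (simp add: T.scale eig)
    have "a j = 0" if j: "j \<in> I" "lam j \<noteq> c" for j
    proof -
      \<comment> \<open>Pairing the two expressions for \<open>T f\<close> with \<open>v j\<close>
        isolates the j-th coefficient and yields (c - lam j) * a j = 0 after cancelling a nonzero
        norm.\<close>
      have "c * (a j * hprod Y (v j) (v j)) = hprod Y (T f) (v j)"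
        using f(2) coeff[OF j(1), of a] a by (simp add: hprod_scale_left)
      also have "\<dots> = a j * lam j * hprod Y (v j) (v j)"
        unfolding Tf by (rule coeff[OF j(1)])
      finally show ?thesis using pos[OF j(1)] j(2) by auto
    qed
    with a show ?thesis by blast
  qed
  let ?I = "{i \<in> I. lam i = c}"
  have "eigenspace (L Y) T c \<subseteq> cfun.span (v ` ?I)"
  proof
    fix f assume "f \<in> eigenspace (L Y) T c"
    then obtain a where a: "f = (\<Sum>i\<in>I. fun_scale (a i) (v i))"
        "\<forall>i\<in>I. lam i \<noteq> c \<longrightarrow> a i = 0"
      using ex by (auto simp: eigenspace_def)
    have "f = (\<Sum>i\<in>?I. fun_scale (a i) (v i))"
      unfolding a(1) using fin a(2)
      by (intro sum.mono_neutral_right) (auto simp: fun_scale_def fun_eq_iff)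
    also have "\<dots> \<in> cfun.span (v ` ?I)"
      by (intro cfun.span_sum cfun.span_scale cfun.span_base) auto
    finally show "f \<in> cfun.span (v ` ?I)" .
  qed
  moreover have "v ` ?I \<subseteq> eigenspace (L Y) T c"
    using mem eig by (auto simp: eigenspace_def)
  moreover have "cfun.independent (v ` ?I)"
    using ind(2) by (rule cfun.independent_mono) auto
  moreover have "inj_on v ?I"
    using ind(1) by (rule inj_on_subset) auto
  ultimately show "multiplicity_of (L Y) T c = card ?I"
    unfolding multiplicity_of_def by (simp add: cfun.dim_unique card_image)
  show "eigenvalues (L Y) T = lam ` I"
  proof safe
    fix c assume "c \<in> eigenvalues (L Y) T"
    then obtain f where f: "f \<in> L Y" "f \<noteq> 0" "T f = fun_scale c f"
      by (auto simp: eigenvalues_def)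
    then obtain a where a: "f = (\<Sum>i\<in>I. fun_scale (a i) (v i))"
        "\<forall>i\<in>I. lam i \<noteq> c \<longrightarrow> a i = 0"
      using ex by blast
    show "c \<in> lam ` I"
    proof (rule ccontr)
      assume "c \<notin> lam ` I"
      then have "f = (\<Sum>i\<in>I. 0)"
        unfolding a(1) using a(2)
        by (intro sum.cong) (auto simp: fun_scale_def fun_eq_iff)
      then show False using f(2) by simp
    qed
  next
    fix i assume "i \<in> I"
    then show "lam i \<in> eigenvalues (L Y) T"
      using mem nz eig by (auto simp: eigenvalues_def)
  qed
qed

section \<open>Waves on the lamplighter group\<close>

locale circle =
  fixes n :: nat
  assumes n3: "3 \<le> n"
begin

section \<open>Coordinates on the circle and the numbering of its edges\<close>

definition shift :: "nat \<Rightarrow> nat \<Rightarrow> nat" where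
  "shift p t = (if p + t < n then p + t else p + t - n)"

definition prv :: "nat \<Rightarrow> nat" where
  "prv x = (if x = 0 then n - 1 else x - 1)"

text \<open>Positions run through \<open>1, \<dots>, n\<close>: the origin \<open>p\<close> itself has position \<open>n\<close>, not \<open>0\<close>.\<close>

definition pos :: "nat \<Rightarrow> nat \<Rightarrow> nat" where
  "pos p x = (if p < x then x - p else x + n - p)"

text \<open>An edge is named by its first endpoint in cyclic order, so sets of edges become subsets
  of \<open>{..<n}\<close>; the two edges at x have the numbers x and \<open>prv x\<close>.\<close>

definition edge :: "nat \<Rightarrow> nat set" where
  "edge i = {i, shift i 1}"

lemma shift_less: "p < n \<Longrightarrow> t \<le> n \<Longrightarrow> shift p t < n"
  by (auto simp: shift_def)

lemma prv_less: "x < n \<Longrightarrow> prv x < n"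
  by (auto simp: prv_def)

lemma pos_range: "p < n \<Longrightarrow> x < n \<Longrightarrow> 1 \<le> pos p x \<and> pos p x \<le> n"
  by (auto simp: pos_def)

lemma shift_pos: "p < n \<Longrightarrow> x < n \<Longrightarrow> shift p (pos p x) = x"
  by (auto simp: pos_def shift_def)

lemma pos_shift: "p < n \<Longrightarrow> 1 \<le> t \<Longrightarrow> t \<le> n \<Longrightarrow> pos p (shift p t) = t"
  by (auto simp: pos_def shift_def)

lemma pos_nxt: "p < n \<Longrightarrow> x < n \<Longrightarrow> pos p (shift x 1) = (if x = p then 1 else Suc (pos p x))"
  using n3 by (auto simp: pos_def shift_def)

lemma prv_shift: "p < n \<Longrightarrow> 1 \<le> t \<Longrightarrow> t \<le> n \<Longrightarrow> prv (shift p t) = shift p (t - 1)"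
  by (auto simp: prv_def shift_def)

lemma shift_prv: "x < n \<Longrightarrow> shift (prv x) 1 = x"
  using n3 by (auto simp: prv_def shift_def)

lemma circle_edges_eq: "circle_edges n = edge ` {..<n}"
proof -
  have "{..<n} = {i. i + 1 < n} \<union> {n - 1}"
    using n3 by auto
  then have "edge ` {..<n} = edge ` {i. i + 1 < n} \<union> {edge (n - 1)}"
    by (simp only: image_Un image_insert image_empty)
  also have "edge ` {i. i + 1 < n} = {{i, i + 1} | i. i + 1 < n}"
    by (auto simp: edge_def shift_def)
  also have "edge (n - 1) = {n - 1, 0}"
    using n3 by (simp add: edge_def shift_def)
  finally show ?thesis by (simp add: circle_edges_def)
qed

lemma edge_eq_iff: "i < n \<Longrightarrow> j < n \<Longrightarrow> edge i = edge j \<longleftrightarrow> i = j"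
  using n3 by (auto simp: edge_def shift_def doubleton_eq_iff split: if_splits)

lemma finite_circle_edges: "finite (circle_edges n)"
  by (simp add: circle_edges_eq)

lemma card_circle_edges: "card (circle_edges n) = n"
  unfolding circle_edges_eq by (subst card_image) (auto simp: inj_on_def edge_eq_iff)

lemma UNIV_bit: "(UNIV :: bit set) = {0, 1}"
  using bit.exhaust by auto

lemma finite_configurations: "finite (circle_edges n \<rightarrow>\<^sub>E (UNIV :: bit set))"
  by (intro finite_PiE finite_circle_edges) (simp add: UNIV_bit)

lemma finite_lamp_states: "finite (lamp_states n)"
  unfolding lamp_states_def using finite_configurations by auto

lemma card_configurations: "card (circle_edges n \<rightarrow>\<^sub>E (UNIV :: bit set)) = 2 ^ n"
proof -
  have "card (UNIV :: bit set) = 2" unfolding UNIV_bit by simp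
  then show ?thesis
    by (simp add: card_PiE finite_circle_edges card_circle_edges)
qed

lemma card_lamp_states: "card (lamp_states n) = n * 2 ^ n"
  by (simp add: lamp_states_def card_cartesian_product card_configurations)

lemma neighbours:
  assumes "x < n"
  shows "{y. circle_adj n x y} = {shift x 1, prv x}" "shift x 1 \<noteq> prv x"
  using circle_nbrs[OF n3 assms] n3 assms by (auto simp: shift_def prv_def)

lemma edge_neighbours:
  assumes "x < n"
  shows "{x, shift x 1} = edge x" "{x, prv x} = edge (prv x)"
  using shift_prv[OF assms] by (auto simp: edge_def)

section \<open>Characters of the lamp group and the waves built on them\<close>

definition flip :: "nat \<Rightarrow> (nat set \<Rightarrow> bit) \<Rightarrow> nat set \<Rightarrow> bit" where
  "flip j \<omega> = \<omega> + indicator {edge j}"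

lemma flip_apply: "flip j \<omega> e = (if e = edge j then \<omega> e + 1 else \<omega> e)"
  by (simp add: flip_def indicator_def)

lemma flip_flip: "flip j (flip j \<omega>) = \<omega>"
  by (rule ext) (auto simp: flip_apply add.assoc)

lemma flip_extensional:
  "j < n \<Longrightarrow> \<omega> \<in> extensional (circle_edges n) \<Longrightarrow> flip j \<omega> \<in> extensional (circle_edges n)"
  by (auto simp: extensional_def flip_apply circle_edges_eq)

lemma flip_mem:
  assumes "j < n" "(\<omega>, x) \<in> lamp_states n" "y < n"
  shows "(flip j \<omega>, y) \<in> lamp_states n"
  using assms by (simp add: lamp_states_iff flip_extensional)

text \<open>This is the character of the lamp group attached to \<open>\<theta>\<close>: the sign is
  -1 to the number of lit lamps on edges of \<open>\<theta>\<close>.\<close>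

definition chi :: "nat set \<Rightarrow> (nat set \<Rightarrow> bit) \<Rightarrow> complex" where
  "chi \<theta> \<omega> = (\<Prod>i\<in>\<theta>. if \<omega> (edge i) = 0 then 1 else - 1)"

lemma chi_flip:
  assumes "\<theta> \<subseteq> {..<n}" "j < n"
  shows "chi \<theta> (flip j \<omega>) = (if j \<in> \<theta> then - chi \<theta> \<omega> else chi \<theta> \<omega>)"
proof -
  have fin: "finite \<theta>" using assms(1) finite_subset by blast
  have eq: "(if flip j \<omega> (edge i) = 0 then 1 else - 1 :: complex)
      = (if i = j then - 1 else 1) * (if \<omega> (edge i) = 0 then 1 else - 1)" if "i \<in> \<theta>" for i
    using that assms edge_eq_iff[of i j] by (cases "\<omega> (edge i)") (auto simp: flip_apply)
  have "chi \<theta> (flip j \<omega>) = (\<Prod>i\<in>\<theta>. if i = j then - 1 else 1) * chi \<theta> \<omega>"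
    unfolding chi_def by (simp add: eq prod.distrib cong: prod.cong)
  also have "(\<Prod>i\<in>\<theta>. if i = j then - 1 else 1 :: complex) = (if j \<in> \<theta> then - 1 else 1)"
    using fin by (simp add: prod.delta)
  finally show ?thesis by simp
qed

lemma chi_square: "chi \<theta> \<omega> * cnj (chi \<theta> \<omega>) = 1"
  unfolding chi_def cnj_prod prod.distrib[symmetric] by (rule prod.neutral) auto

definition wave :: "nat set \<Rightarrow> (nat \<Rightarrow> complex) \<Rightarrow> lamp_state \<Rightarrow> complex" where
  "wave \<theta> g = (\<lambda>(\<omega>, x). if (\<omega>, x) \<in> lamp_states n then chi \<theta> \<omega> * g x else 0)"

lemma wave_in_L: "wave \<theta> g \<in> L (lamp_states n)"
  by (auto simp: wave_def L_def)

text \<open>Summing over the two values of the lamp on an edge cancels the character exactly when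
  that edge lies in \<open>\<theta>\<close>: on the waves with character \<open>\<theta>\<close> the walk is the walk on the circle
  with the edges of \<open>\<theta>\<close> removed.\<close>

lemma markov_op_wave:
  assumes \<theta>: "\<theta> \<subseteq> {..<n}"
    and g: "\<And>x. x < n \<Longrightarrow>
      (if x \<in> \<theta> then 0 else g (shift x 1)) + (if prv x \<in> \<theta> then 0 else g (prv x)) = 2 * c * g x"
  shows "markov_op n (wave \<theta> g) = fun_scale c (wave \<theta> g)"
proof (rule ext, clarify)
  fix \<omega> x
  show "markov_op n (wave \<theta> g) (\<omega>, x) = fun_scale c (wave \<theta> g) (\<omega>, x)"
  proof (cases "(\<omega>, x) \<in> lamp_states n")
    case True
    then have mem: "(\<omega>, y) \<in> lamp_states n" if "y < n" for y
      using that by (auto simp: lamp_states_iff)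
    have x: "x < n" using True by (simp add: lamp_states_iff)
    have step: "wave \<theta> g (\<omega>, y) + wave \<theta> g (flip j \<omega>, y)
        = (if j \<in> \<theta> then 0 else 2 * chi \<theta> \<omega> * g y)" if "j < n" "y < n" for j y
      using mem[OF that(2)] flip_mem[OF that(1) True that(2)] chi_flip[OF \<theta> that(1), of \<omega>]
      by (simp add: wave_def)
    have "markov_op n (wave \<theta> g) (\<omega>, x) = 1 / 4 *
        ((wave \<theta> g (\<omega>, shift x 1) + wave \<theta> g (flip x \<omega>, shift x 1))
        + (wave \<theta> g (\<omega>, prv x) + wave \<theta> g (flip (prv x) \<omega>, prv x)))"
      using True neighbours[OF x] edge_neighbours[OF x] by (simp add: markov_op_def flip_def)
    also have "\<dots> = 1 / 4 * ((if x \<in> \<theta> then 0 else 2 * chi \<theta> \<omega> * g (shift x 1))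
        + (if prv x \<in> \<theta> then 0 else 2 * chi \<theta> \<omega> * g (prv x)))"
      using x n3 by (simp only: step shift_less prv_less)
    also have "\<dots> = chi \<theta> \<omega> / 2 *
        ((if x \<in> \<theta> then 0 else g (shift x 1)) + (if prv x \<in> \<theta> then 0 else g (prv x)))"
      by (auto simp: algebra_simps)
    also have "\<dots> = fun_scale c (wave \<theta> g) (\<omega>, x)"
      unfolding g[OF x] using True by (simp add: wave_def fun_scale_def)
    finally show ?thesis .
  qed (simp add: markov_op_def wave_def fun_scale_def)
qed

text \<open>Flipping the lamp on an edge that lies in exactly one of the two sets permutes the
  states and negates every summand, so the sum equals its own negative.\<close>

lemma hprod_wave_distinct:
  assumes "\<theta> \<subseteq> {..<n}" "\<theta>' \<subseteq> {..<n}" "\<theta> \<noteq> \<theta>'"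
  shows "hprod (lamp_states n) (wave \<theta> f) (wave \<theta>' g) = 0"
proof -
  obtain j where j: "j < n" "(j \<in> \<theta>) \<noteq> (j \<in> \<theta>')" using assms by blast
  let ?F = "\<lambda>u. wave \<theta> f u * cnj (wave \<theta>' g u)"
  let ?flip = "\<lambda>(\<omega>, x). (flip j \<omega>, x)"
  have "(\<Sum>u\<in>lamp_states n. ?F u) = (\<Sum>u\<in>lamp_states n. ?F (?flip u))"
    by (rule sum.reindex_bij_witness[of _ ?flip ?flip])
      (auto simp: flip_flip lamp_states_iff flip_extensional[OF j(1)])
  also have "\<dots> = (\<Sum>u\<in>lamp_states n. - ?F u)"
  proof (rule sum.cong[OF refl])
    fix u assume "u \<in> lamp_states n"
    moreover obtain \<omega> x where ux: "u = (\<omega>, x)" by (cases u)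
    ultimately have u: "(\<omega>, x) \<in> lamp_states n" by simp
    then have "(flip j \<omega>, x) \<in> lamp_states n"
      using flip_mem[OF j(1) u, of x] by (simp add: lamp_states_iff)
    with u show "?F (?flip u) = - ?F u"
      using j(2) by (auto simp: ux wave_def chi_flip[OF assms(1) j(1)] chi_flip[OF assms(2) j(1)])
  qed
  finally show ?thesis by (simp add: hprod_def sum_negf)
qed

text \<open>The character has modulus 1 and cancels against its conjugate; the factor 2^n counts the
  configurations.\<close>

lemma hprod_wave_same:
  "hprod (lamp_states n) (wave \<theta> f) (wave \<theta> g) = 2 ^ n * (\<Sum>x<n. f x * cnj (g x))"
proof -
  have "hprod (lamp_states n) (wave \<theta> f) (wave \<theta> g)
      = (\<Sum>u\<in>lamp_states n. f (snd u) * cnj (g (snd u)))"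
    unfolding hprod_def
  proof (rule sum.cong[OF refl], clarify)
    fix \<omega> x assume "(\<omega>, x) \<in> lamp_states n"
    moreover have "chi \<theta> \<omega> * f x * (cnj (chi \<theta> \<omega>) * cnj (g x))
        = (chi \<theta> \<omega> * cnj (chi \<theta> \<omega>)) * (f x * cnj (g x))" by (simp only: mult_ac)
    ultimately show "wave \<theta> f (\<omega>, x) * cnj (wave \<theta> g (\<omega>, x))
        = f (snd (\<omega>, x)) * cnj (g (snd (\<omega>, x)))"
      by (simp add: wave_def chi_square)
  qed
  also have "\<dots> = (\<Sum>\<omega>\<in>circle_edges n \<rightarrow>\<^sub>E (UNIV :: bit set). \<Sum>x<n. f x * cnj (g x))"
    by (simp only: lamp_states_def atLeast0LessThan sum.cartesian_product' snd_conv)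
  finally show ?thesis by (simp add: card_configurations)
qed

lemma wave_nonzero:
  assumes "x < n" "g x \<noteq> 0"
  shows "wave \<theta> g \<noteq> 0"
proof
  assume w: "wave \<theta> g = 0"
  obtain \<omega> where "\<omega> \<in> circle_edges n \<rightarrow>\<^sub>E (UNIV :: bit set)"
    using card_configurations by (metis card.empty ex_in_conv power_not_zero zero_neq_numeral)
  then have "wave \<theta> g (\<omega>, x) = chi \<theta> \<omega> * g x"
    using assms(1) by (simp add: wave_def lamp_states_def)
  with w have "chi \<theta> \<omega> = 0" using assms(2) by simp
  then show False using chi_square[of \<theta> \<omega>] by simp
qed

text \<open>Adjacency is symmetric and every state has the same degree 4, so the kernel of the walk
  is a real symmetric matrix.\<close>

lemma markov_op_selfadjoint:
  "hprod (lamp_states n) (markov_op n f) g = hprod (lamp_states n) f (markov_op n g)"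
proof -
  let ?Y = "lamp_states n"
  have M: "markov_op n h u = (\<Sum>v\<in>?Y. if lamp_adj n u v then h v / 4 else 0)" if "u \<in> ?Y" for h u
  proof -
    have "{v. lamp_adj n u v} = {v \<in> ?Y. lamp_adj n u v}" by (auto simp: lamp_adj_def)
    then show ?thesis
      using markov_op_simple_random_walk[OF n3 that] finite_lamp_states
      by (simp add: sum_divide_distrib flip: sum.inter_filter)
  qed
  have sym: "lamp_adj n u v \<longleftrightarrow> lamp_adj n v u" for u v
    by (auto simp: lamp_adj_def circle_adj_def insert_commute)
  have "hprod ?Y (markov_op n f) g
      = (\<Sum>u\<in>?Y. \<Sum>v\<in>?Y. if lamp_adj n u v then f v / 4 * cnj (g u) else 0)"
    unfolding hprod_def by (auto simp: M sum_distrib_right intro!: sum.cong)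
  also have "\<dots> = (\<Sum>v\<in>?Y. \<Sum>u\<in>?Y. if lamp_adj n u v then f v / 4 * cnj (g u) else 0)"
    by (rule sum.swap)
  also have "\<dots> = hprod ?Y f (markov_op n g)"
    unfolding hprod_def by (auto simp: M sum_distrib_left sym intro!: sum.cong)
  finally show ?thesis .
qed

end

section \<open>Eigenfunctions on arcs\<close>

lemma card_constrained_subsets:
  assumes "finite U" "A \<subseteq> U" "B \<subseteq> U" "A \<inter> B = {}"
  shows "card {S. S \<subseteq> U \<and> A \<subseteq> S \<and> S \<inter> B = {}} = 2 ^ (card U - card A - card B)"
proof -
  have fin: "finite A" "finite B" using assms finite_subset by blast+
  have "{S. S \<subseteq> U \<and> A \<subseteq> S \<and> S \<inter> B = {}} = (\<lambda>S. A \<union> S) ` Pow (U - A - B)"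
  proof safe
    fix S assume S: "S \<subseteq> U" "A \<subseteq> S" "S \<inter> B = {}"
    then have "S = A \<union> (S - A)" "S - A \<in> Pow (U - A - B)" by auto
    then show "S \<in> (\<lambda>S. A \<union> S) ` Pow (U - A - B)" by blast
  qed (use assms in auto)
  moreover have "inj_on (\<lambda>S. A \<union> S) (Pow (U - A - B))"
    by (auto simp: inj_on_def)
  moreover have "card (U - A - B) = card U - card A - card B"
  proof -
    have "card (U - A - B) = card (U - A) - card B"
      using assms fin by (intro card_Diff_subset) auto
    then show ?thesis using assms fin by (simp add: card_Diff_subset)
  qed
  ultimately show ?thesis
    using assms(1) by (simp add: card_image card_Pow)
qed

context circle
begin

text \<open>The sets \<open>\<theta>\<close> of removed edges for which the vertices \<open>p + 1, \<dots>, p + m\<close> form a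
  connected component of the rest of the circle; for \<open>m = n\<close> the two end edges coincide.\<close>

definition gaps :: "nat \<Rightarrow> nat \<Rightarrow> nat set set" where
  "gaps p m = {\<theta>. \<theta> \<subseteq> {..<n} \<and> p \<in> \<theta> \<and> shift p m \<in> \<theta> \<and> (\<forall>i\<in>{1..<m}. shift p i \<notin> \<theta>)}"

text \<open>This is a Dirichlet eigenfunction of the path, extended by zero: the sine vanishes at
  positions 0 and m + 1, just outside the arc.\<close>

definition arc :: "nat \<Rightarrow> nat \<Rightarrow> nat \<Rightarrow> nat \<Rightarrow> complex" where
  "arc p m h x = (if pos p x \<le> m then of_real (sin (real (pos p x) * (real h * pi / real (m + 1)))) else 0)"

text \<open>On the arc the neighbour terms are \<open>s (t + 1)\<close> and \<open>s (t - 1)\<close>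
  even at the ends, where the removed edge gives 0 = \<open>s (m + 1)\<close> and 0 =
  \<open>s 0\<close>; the addition formula for the sine then applies. Off the arc both terms vanish,
  as the arc can only be entered across a removed edge.\<close>

lemma arc_eigenfunction:
  assumes p: "p < n" and m: "1 \<le> m" "m \<le> n" and \<theta>: "\<theta> \<in> gaps p m" and x: "x < n"
  shows "(if x \<in> \<theta> then 0 else arc p m h (shift x 1)) + (if prv x \<in> \<theta> then 0 else arc p m h (prv x))
    = 2 * of_real (cos (real h * pi / real (m + 1))) * arc p m h x"
proof -
  define a where "a = real h * pi / real (m + 1)"
  define s :: "nat \<Rightarrow> complex" where "s k = of_real (sin (real k * a))" for k
  define t where "t = pos p x"
  have t: "1 \<le> t" "t \<le> n" "shift p t = x"
    using pos_range[OF p x] shift_pos[OF p x] by (auto simp: t_def)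
  have arc: "arc p m h y = (if pos p y \<le> m then s (pos p y) else 0)" for y
    by (simp add: arc_def s_def a_def)
  have s0: "s 0 = 0" by (simp add: s_def)
  have "real (m + 1) * a = real h * pi" by (simp add: a_def)
  then have sm: "s (m + 1) = 0" by (simp add: s_def sin_npi)
  have in\<theta>: "p \<in> \<theta>" "shift p m \<in> \<theta>" and notin: "\<And>i. 1 \<le> i \<Longrightarrow> i < m \<Longrightarrow> shift p i \<notin> \<theta>"
    using \<theta> by (auto simp: gaps_def)
  have A: "(if x \<in> \<theta> then 0 else arc p m h (shift x 1)) = (if t \<le> m then s (t + 1) else 0)"
  proof (cases t m rule: linorder_cases)
    case less
    then have "x \<notin> \<theta>" using notin[of t] t by auto
    \<comment> \<open>The origin is the only vertex where the position drops from n to 1 instead of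
      growing by one; its outgoing edge is removed.\<close>
    moreover from this have "x \<noteq> p" using in\<theta> by auto
    ultimately show ?thesis
      using less pos_nxt[OF p x] by (simp add: arc flip: t_def)
  next
    case equal
    then show ?thesis using in\<theta> t sm by auto
  next
    case greater
    then show ?thesis using in\<theta> pos_nxt[OF p x] by (auto simp: arc simp flip: t_def)
  qed
  have B: "(if prv x \<in> \<theta> then 0 else arc p m h (prv x)) = (if t \<le> m then s (t - 1) else 0)"
  proof (cases "t = 1")
    case True
    then have "prv x = p" using prv_shift[OF p t(1,2)] t p by (simp add: shift_def)
    then show ?thesis using True in\<theta> s0 by simp
  next
    case False
    then have t1: "1 \<le> t - 1" "t - 1 \<le> n" using t by auto
    have pr: "prv x = shift p (t - 1)" using prv_shift[OF p t(1,2)] t by simp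
    have ps: "pos p (prv x) = t - 1" unfolding pr by (rule pos_shift[OF p t1])
    show ?thesis
    proof (cases "t \<le> m")
      case True
      then have "prv x \<notin> \<theta>" unfolding pr using t1 by (intro notin) auto
      moreover have "t - 1 \<le> m" using True by simp
      ultimately show ?thesis using True ps by (simp add: arc)
    next
      case f: False
      show ?thesis
      proof (cases "t - 1 = m")
        case True
        \<comment> \<open>Here x is the first vertex past the arc. Its predecessor is on the arc,
          but the edge between them is \<open>shift p m\<close>, which is removed.\<close>
        then show ?thesis using f in\<theta> pr by simp
      next
        case False
        then have "\<not> t - 1 \<le> m" using f by simp
        then show ?thesis using f ps by (simp add: arc)
      qed
    qed
  qed
  have "s (t + 1) + s (t - 1) = 2 * of_real (cos a) * s t"
  proof -
    have *: "real (t + 1) * a = real t * a + a" "real (t - 1) * a = real t * a - a"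
      using t by (auto simp: algebra_simps of_nat_diff)
    have "sin (real (t + 1) * a) + sin (real (t - 1) * a) = 2 * cos a * sin (real t * a)"
      unfolding * sin_add sin_diff by simp
    then show ?thesis
      unfolding s_def by (metis of_real_add of_real_mult of_real_numeral)
  qed
  moreover have "arc p m h x = (if t \<le> m then s t else 0)" by (simp add: arc t_def)
  ultimately show ?thesis
    unfolding A B a_def[symmetric] by simp
qed

lemma arc_nonzero:
  assumes "p < n" "1 \<le> h" "h \<le> m"
  shows "arc p m h (shift p 1) \<noteq> 0"
proof -
  have "real h * pi < real (m + 1) * pi" using assms by simp
  then have "0 < real h * pi / real (m + 1)" "real h * pi / real (m + 1) < pi"
    using assms by (auto simp: pos_divide_less_eq mult.commute)
  then have "sin (real h * pi / real (m + 1)) \<noteq> 0"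
    using sin_gt_zero by fastforce
  moreover have "pos p (shift p 1) = 1" using assms n3 by (intro pos_shift) auto
  ultimately show ?thesis using assms by (simp add: arc_def)
qed

text \<open>If two arcs cut out by the same \<open>\<theta>\<close> share x but have different
  starts, the start nearer to x lies strictly inside the other arc, where no edge is removed; yet
  the edge leaving a start belongs to \<open>\<theta>\<close>. With equal starts, the end edge of
  the shorter arc leads to the same contradiction.\<close>

lemma arcs_disjoint:
  assumes "p < n" "p' < n" "\<theta> \<in> gaps p m" "\<theta> \<in> gaps p' m'" "m \<le> n" "m' \<le> n" "x < n"
    and "pos p x \<le> m" "pos p' x \<le> m'"
  shows "p = p' \<and> m = m'"
proof -
  have no: "\<not> pos q x < pos q' x"
    if "q < n" "q' < n" "\<theta> \<in> gaps q k" "\<theta> \<in> gaps q' k'" "pos q' x \<le> k'" for q q' k k'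
  proof
    assume lt: "pos q x < pos q' x"
    have "q = shift q' (pos q' x - pos q x)"
      using lt that(1,2) assms(7) by (auto simp: pos_def shift_def split: if_splits)
    moreover have "pos q' x - pos q x \<in> {1..<k'}"
      using that(5) lt pos_range[OF that(1) assms(7)] by auto
    then have "shift q' (pos q' x - pos q x) \<notin> \<theta>"
      using that(4) by (simp only: gaps_def mem_Collect_eq) blast
    ultimately show False using that(3) by (simp add: gaps_def)
  qed
  have "pos p x = pos p' x"
    using no[of p p' m m'] no[of p' p m' m] assms by auto
  then have p: "p = p'"
    using assms(1,2,7) by (auto simp: pos_def split: if_splits)
  moreover have "1 \<le> m" "1 \<le> m'"
    using pos_range[OF assms(1,7)] pos_range[OF assms(2,7)] assms(8,9) by auto
  then have "m = m'"
    using assms(3,4) p by (cases m m' rule: linorder_cases) (auto simp: gaps_def)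
  ultimately show ?thesis by simp
qed

text \<open>For m < n two end edges are forced in and m - 1 inner edges forced out, which leaves n -
  m - 1 free. For m = n the ends coincide and nothing is free.\<close>

lemma card_gaps:
  assumes p: "p < n" and m: "1 \<le> m" "m \<le> n"
  shows "card (gaps p m) = (if m < n then 2 ^ (n - m - 1) else 1)"
proof -
  let ?A = "{p, shift p m}" and ?B = "shift p ` {1..<m}"
  have inj: "inj_on (shift p) {1..n}"
    using pos_shift[OF p] by (intro inj_on_inverseI[of _ "pos p"]) auto
  have "card ?B = m - 1"
    by (subst card_image[OF inj_on_subset[OF inj]]) (use m in auto)
  moreover have "card ?A = (if m < n then 2 else 1)"
    using p m by (auto simp: shift_def)
  moreover have "?A \<inter> ?B = {}"
    using p m by (auto simp: shift_def split: if_splits)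
  moreover have "?A \<subseteq> {..<n}" "?B \<subseteq> {..<n}"
    using p m shift_less[OF p] by auto
  moreover have "gaps p m = {S. S \<subseteq> {..<n} \<and> ?A \<subseteq> S \<and> S \<inter> ?B = {}}"
    by (auto simp: gaps_def)
  ultimately show ?thesis
    using m card_constrained_subsets[of "{..<n}" ?A ?B] by (simp add: diff_diff_add)
qed

section \<open>Indexing the eigenfunctions and counting them\<close>

definition gap_weight :: "nat \<Rightarrow> nat" where
  "gap_weight m = (if m < n then 2 ^ (n - m - 1) else 1)"

definition components :: "nat \<Rightarrow> (nat \<times> nat set) set" where
  "components m = Sigma {..<n} (\<lambda>p. gaps p m)"

lemma finite_components: "finite (components m)"
proof -
  have "finite (gaps p m)" for p
    by (rule finite_subset[of _ "Pow {..<n}"]) (auto simp: gaps_def)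
  then show ?thesis by (simp add: components_def)
qed

lemma card_components:
  assumes "1 \<le> m" "m \<le> n"
  shows "card (components m) = n * gap_weight m"
proof -
  have "finite (gaps p m)" for p
    by (rule finite_subset[of _ "Pow {..<n}"]) (auto simp: gaps_def)
  then show ?thesis
    using card_gaps[OF _ assms] by (simp add: components_def gap_weight_def)
qed

definition modes :: "(nat \<times> nat) set" where
  "modes = Sigma {1..n} (\<lambda>m. {1..m})"

type_synonym mode = "nat + (nat \<times> nat) \<times> (nat \<times> nat set)"

text \<open>The pair (m, h), which alone determines the eigenvalue of an arc mode, is kept apart
  from the component (p, \<open>\<theta>\<close>), so that multiplicities become sums of component
  counts.\<close>

definition index :: "mode set" where
  "index = {..<n} <+> Sigma modes (\<lambda>(m, h). components m)"

fun efun :: "mode \<Rightarrow> lamp_state \<Rightarrow> complex" where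
  "efun (Inl j) = wave {} (\<lambda>x. cis (2 * pi * real j / real n) ^ x)"
| "efun (Inr ((m, h), (p, \<theta>))) = wave \<theta> (arc p m h)"

fun evalue :: "mode \<Rightarrow> real" where
  "evalue (Inl j) = cos (2 * pi * real j / real n)"
| "evalue (Inr ((m, h), (p, \<theta>))) = cos (real h * pi / real (m + 1))"

lemma finite_index: "finite index"
  by (auto simp: index_def modes_def finite_components split: prod.splits intro!: finite_SigmaI)

text \<open>The sum of m * 2^(k - m) for m = 1, ..., k is 2^(k + 1) - k - 2. With k = n - 1, the
  full arcs add n and the circle adds 1, which makes 2^n after the common factor n is taken
  out.\<close>

lemma card_index: "card index = n * 2 ^ n"
proof -
  have *: "(\<Sum>m=1..k. m * 2 ^ (k - m)) + k + 2 = 2 ^ (k + 1)" for k :: nat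
  proof (induction k)
    case (Suc k)
    have "(\<Sum>m=1..Suc k. m * 2 ^ (Suc k - m)) = 2 * (\<Sum>m=1..k. m * 2 ^ (k - m)) + Suc k"
      by (simp add: Suc_diff_le sum_distrib_left mult_ac)
    then show ?case using Suc by simp
  qed simp
  obtain k where k: "n = Suc k" using n3 by (cases n) auto
  have "card (Sigma modes (\<lambda>(m, h). components m)) = (\<Sum>(m, h)\<in>modes. n * gap_weight m)"
    by (subst card_SigmaI)
      (auto simp: modes_def finite_components card_components split: prod.splits intro!: sum.cong)
  also have "\<dots> = (\<Sum>m=1..n. \<Sum>h=1..m. n * gap_weight m)"
    unfolding modes_def by (subst sum.Sigma) auto
  also have "\<dots> = n * (\<Sum>m=1..n. m * gap_weight m)"
    by (simp add: sum_distrib_left mult_ac)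
  also have "(\<Sum>m=1..n. m * gap_weight m) = (\<Sum>m=1..k. m * 2 ^ (k - m)) + n"
  proof -
    have "gap_weight n = 1" by (simp add: gap_weight_def)
    moreover have "(\<Sum>m=1..k. m * gap_weight m) = (\<Sum>m=1..k. m * 2 ^ (k - m))"
      unfolding gap_weight_def using k by (intro sum.cong refl) auto
    moreover have "{1..n} = insert n {1..k}" unfolding k by auto
    ultimately show ?thesis by (simp add: k)
  qed
  finally have "card index = n * (1 + (\<Sum>m=1..k. m * 2 ^ (k - m)) + n)"
    unfolding index_def
    by (subst card_Plus)
      (auto simp: modes_def finite_components algebra_simps split: prod.splits intro!: finite_SigmaI)
  also have "1 + (\<Sum>m=1..k. m * 2 ^ (k - m)) + n = 2 ^ n"
    using *[of k] k by simp
  finally show ?thesis .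
qed

lemma cis_power_n: "cis (2 * pi * real j / real n) ^ n = 1"
proof -
  have "real n * (2 * pi * real j / real n) = 2 * pi * real j" using n3 by simp
  then show ?thesis by (simp add: DeMoivre complex_eq_iff cos_int_2pin[of "int j", simplified] sin_int_2pin[of "int j", simplified])
qed

text \<open>Powers of an n-th root of unity wrap around the circle consistently, and stepping back
  multiplies by the inverse \<open>cnj z\<close>; the eigenvalue comes from z + cnj z.\<close>

lemma cycle_eigenfunction:
  fixes z :: complex
  assumes z: "z ^ n = 1" "cmod z = 1" and x: "x < n"
  shows "z ^ shift x 1 + z ^ prv x = 2 * of_real (Re z) * z ^ x"
proof -
  have inv: "z * cnj z = 1" using z(2) by (simp add: complex_norm_square[symmetric])
  have 1: "z ^ shift x 1 = z * z ^ x"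
  proof (cases "Suc x = n")
    case True
    then have "z ^ n = z * z ^ x" by auto
    then show ?thesis using True z(1) by (simp add: shift_def)
  qed (use x in \<open>simp add: shift_def\<close>)
  have "z * z ^ prv x = z ^ x"
  proof (cases x)
    case 0
    then have "z * z ^ prv x = z ^ n" using n3 by (simp add: prv_def flip: power_Suc)
    then show ?thesis using 0 z(1) by simp
  qed (simp add: prv_def)
  then have "cnj z * z ^ x = (z * cnj z) * z ^ prv x" by (metis mult.commute mult.left_commute)
  then have 2: "z ^ prv x = cnj z * z ^ x" using inv by simp
  have "z + cnj z = 2 * of_real (Re z)" by (simp add: complex_add_cnj)
  then show ?thesis unfolding 1 2 by (metis distrib_right)
qed

end

section \<open>The eigenbasis\<close>

text \<open>Both angles lie in [0, pi], where the cosine is injective. The end points are included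
  so that 1 and -1 can be treated as the fractions 0/1 and 1/1.\<close>

lemma cos_fraction_eq_iff:
  fixes h k m h' :: nat
  assumes "0 < k" "h \<le> k" "0 < m" "h' \<le> m"
  shows "cos (real h' * pi / real m) = cos (real h * pi / real k) \<longleftrightarrow> h' * k = h * m"
proof
  have le_pi: "real a * pi / real b \<le> pi" if "a \<le> b" "0 < b" for a b :: nat
  proof -
    have "real a * pi \<le> real b * pi" using that by simp
    then show ?thesis using that by (simp add: pos_divide_le_eq mult.commute[of pi])
  qed
  assume eq: "cos (real h' * pi / real m) = cos (real h * pi / real k)"
  have "real h' * pi / real m = real h * pi / real k"
    by (rule cos_inj_pi[OF _ _ _ _ eq]) (use assms in \<open>auto intro: le_pi\<close>)
  then have "pi * (real h' * real k) = pi * (real h * real m)"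
    using assms by (simp add: field_simps)
  then have "real (h' * k) = real (h * m)" by simp
  then show "h' * k = h * m" by linarith
next
  assume "h' * k = h * m"
  then have "real h' * real k = real h * real m" by (metis of_nat_mult)
  then have "real h' * pi / real m = real h * pi / real k"
    using assms by (simp add: field_simps)
  then show "cos (real h' * pi / real m) = cos (real h * pi / real k)" by simp
qed

context circle
begin

lemma efun_in_L: "efun i \<in> L (lamp_states n)"
  by (cases i rule: efun.cases) (simp_all add: wave_in_L)

lemma efun_nonzero:
  assumes "i \<in> index"
  shows "efun i \<noteq> 0"
proof (cases i rule: efun.cases)
  case (1 j)
  show ?thesis unfolding 1 efun.simps by (rule wave_nonzero[of 0]) (use n3 in auto)
next
  case (2 m h p \<theta>)
  then have "p < n" "1 \<le> h" "h \<le> m"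
    using assms by (auto simp: index_def modes_def components_def)
  then show ?thesis
    unfolding 2 efun.simps using n3 by (intro wave_nonzero[of "shift p 1"] arc_nonzero shift_less) auto
qed

lemma markov_op_efun:
  assumes "i \<in> index"
  shows "markov_op n (efun i) = fun_scale (of_real (evalue i)) (efun i)"
proof (cases i rule: efun.cases)
  case (1 j)
  show ?thesis
    unfolding 1 efun.simps
  proof (rule markov_op_wave)
    fix x assume "x < n"
    then show "(if x \<in> {} then 0 else cis (2 * pi * real j / real n) ^ shift x 1)
        + (if prv x \<in> {} then 0 else cis (2 * pi * real j / real n) ^ prv x)
        = 2 * of_real (evalue (Inl j)) * cis (2 * pi * real j / real n) ^ x"
      using cycle_eigenfunction[OF cis_power_n[of j] norm_cis] by simp
  qed simp
next
  case (2 m h p \<theta>)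
  then have "p < n" "1 \<le> m" "m \<le> n" "\<theta> \<in> gaps p m"
    using assms by (auto simp: index_def modes_def components_def)
  then show ?thesis
    unfolding 2 efun.simps evalue.simps
    by (intro markov_op_wave arc_eigenfunction) (auto simp: gaps_def)
qed

text \<open>Different sets of removed edges are separated by their characters, different arcs of one
  set by their supports, and different frequencies on one arc by their eigenvalues, which avoids the
  orthogonality relations for sines.\<close>

lemma efun_orthogonal:
  assumes "i \<in> index" "i' \<in> index" "i \<noteq> i'"
  shows "hprod (lamp_states n) (efun i) (efun i') = 0"
proof -
  \<comment> \<open>The set of an arc mode contains p and so differs from the empty set of the
    circle modes.\<close>
  have mixed: "hprod (lamp_states n) (efun (Inl j)) (efun (Inr ((m, h), (p, \<theta>)))) = 0"
    if "Inr ((m, h), (p, \<theta>)) \<in> index" for j m h p \<theta>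
  proof -
    have "\<theta> \<subseteq> {..<n}" "p \<in> \<theta>"
      using that by (auto simp: index_def components_def gaps_def)
    then show ?thesis
      unfolding efun.simps by (intro hprod_wave_distinct) auto
  qed
  show ?thesis
  proof (cases i rule: efun.cases; cases i' rule: efun.cases)
    fix j j' assume i: "i = Inl j" "i' = Inl j'"
    then have jj: "j < n" "j' < n" "j \<noteq> j'" using assms by (auto simp: index_def)
    define z where "z = cis (2 * pi * real j / real n)"
    define w where "w = cis (2 * pi * real j' / real n)"
    \<comment> \<open>Eigenvalues cannot separate circle modes, since j and n - j share one. A
      geometric sum is used instead, and its ratio must not be 1.\<close>
    have "z * cnj w \<noteq> 1"
    proof
      assume "z * cnj w = 1"
      then have "cos (2 * pi * real j / real n - 2 * pi * real j' / real n) = 1"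
        by (simp add: z_def w_def cis_cnj cis_mult complex_eq_iff)
      then obtain l :: int where "2 * pi * real j / real n - 2 * pi * real j' / real n = l * 2 * pi"
        by (auto simp: cos_one_2pi_int)
      then have "pi * (real j - real j') = pi * (l * real n)"
        using n3 by (simp add: field_simps)
      then have "real j - real j' = l * real n" by simp
      then have "of_int (int j - int j') = (of_int (l * int n) :: real)" by simp
      then have l: "int j - int j' = l * int n" by linarith
      have "\<bar>int j - int j'\<bar> < int n" using jj by auto
      then have "l = 0" using n3 unfolding l by (simp add: abs_mult)
      then show False using l jj by simp
    qed
    moreover have "(z * cnj w) ^ n = 1"
      using cis_power_n by (simp add: z_def w_def power_mult_distrib flip: complex_cnj_power)
    ultimately have "(\<Sum>x<n. (z * cnj w) ^ x) = 0"
      by (simp add: geometric_sum)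
    then show ?thesis
      unfolding i efun.simps hprod_wave_same z_def[symmetric] w_def[symmetric]
      by (simp add: power_mult_distrib)
  next
    fix j m h p \<theta> assume "i = Inl j" "i' = Inr ((m, h), (p, \<theta>))"
    then show ?thesis using mixed assms by blast
  next
    fix j m h p \<theta> assume "i = Inr ((m, h), (p, \<theta>))" "i' = Inl j"
    then show ?thesis using mixed assms hprod_commute_eq_0 by blast
  next
    fix m h p \<theta> m' h' p' \<theta>'
    assume i: "i = Inr ((m, h), (p, \<theta>))" "i' = Inr ((m', h'), (p', \<theta>'))"
    have h: "1 \<le> h" "h \<le> m" "m \<le> n" "1 \<le> h'" "h' \<le> m'" "m' \<le> n" "p < n" "p' < n"
      and \<theta>: "\<theta> \<in> gaps p m" "\<theta>' \<in> gaps p' m'"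
      using assms i by (auto simp: index_def modes_def components_def)
    consider "\<theta> \<noteq> \<theta>'" | "\<theta> = \<theta>'" "p = p' \<and> m = m'" | "\<theta> = \<theta>'" "\<not> (p = p' \<and> m = m')"
      by blast
    then show ?thesis
    proof cases
      case 1
      then show ?thesis
        unfolding i efun.simps using \<theta> by (intro hprod_wave_distinct) (auto simp: gaps_def)
    next
      case 2
      then have "h \<noteq> h'" using assms i by auto
      then have "cos (real h * pi / real (m + 1)) \<noteq> cos (real h' * pi / real (m + 1))"
      proof -
        have iff: "cos (real h * pi / real (m + 1)) = cos (real h' * pi / real (m + 1))
            \<longleftrightarrow> h * (m + 1) = h' * (m + 1)"
          using h 2 by (intro cos_fraction_eq_iff) auto
        show ?thesis unfolding iff mult_cancel2 using \<open>h \<noteq> h'\<close> by simp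
      qed
      then have ne: "evalue i \<noteq> evalue i'" using i 2 by simp
      show ?thesis
        by (rule hprod_eq_0_if_eigenvalues_differ[OF markov_op_selfadjoint
              markov_op_efun[OF assms(1)] markov_op_efun[OF assms(2)] ne])
    next
      case 3
      have "arc p m h x * cnj (arc p' m' h' x) = 0" if "x < n" for x
        using arcs_disjoint[OF h(7,8) \<theta>(1) \<theta>(2)[folded 3(1)] h(3,6) that] 3(2)
        by (auto simp: arc_def)
      then have "(\<Sum>x<n. arc p m h x * cnj (arc p' m' h' x)) = 0"
        by (intro sum.neutral) auto
      then show ?thesis
        unfolding i efun.simps 3(1) hprod_wave_same by simp
    qed
  qed
qed

lemma markov_op_spectrum:
  shows "multiplicity_of (L (lamp_states n)) (markov_op n) (of_real c) = card {i \<in> index. evalue i = c}"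
    and "eigenvalues (L (lamp_states n)) (markov_op n) = (\<lambda>i. of_real (evalue i)) ` index"
  using orthogonal_eigenbasis[OF finite_lamp_states finite_index _ linear_markov_op
      efun_in_L efun_nonzero efun_orthogonal markov_op_efun]
  by (simp_all add: card_index card_lamp_states)

lemma multiplicity_eq:
  "multiplicity_of (L (lamp_states n)) (markov_op n) (of_real c)
    = card {j. j < n \<and> cos (2 * pi * real j / real n) = c}
    + n * (\<Sum>(m, h) | (m, h) \<in> modes \<and> cos (real h * pi / real (m + 1)) = c. gap_weight m)"
proof -
  let ?K = "{(m, h). (m, h) \<in> modes \<and> cos (real h * pi / real (m + 1)) = c}"
  have fin: "finite ?K"
    by (rule finite_subset[of _ modes]) (auto simp: modes_def)
  have "{i \<in> index. evalue i = c}
      = {j. j < n \<and> cos (2 * pi * real j / real n) = c} <+> Sigma ?K (\<lambda>(m, h). components m)"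
    by (auto simp: index_def)
  then have "card {i \<in> index. evalue i = c} = card {j. j < n \<and> cos (2 * pi * real j / real n) = c}
      + card (Sigma ?K (\<lambda>(m, h). components m))"
    using fin by (subst card_Plus[symmetric]) (auto simp: finite_components split: prod.splits intro!: finite_SigmaI)
  also have "card (Sigma ?K (\<lambda>(m, h). components m)) = (\<Sum>(m, h)\<in>?K. n * gap_weight m)"
    using fin by (subst card_SigmaI)
      (auto simp: modes_def finite_components card_components split: prod.splits intro!: sum.cong)
  also have "\<dots> = n * (\<Sum>(m, h)\<in>?K. gap_weight m)"
    by (simp add: sum_distrib_left case_prod_unfold)
  finally show ?thesis by (simp add: markov_op_spectrum)
qed

text \<open>The arc on k * j - 1 vertices has weight 2^(n - k * j), a geometric sequence in j of
  ratio 2^(-k). For r > 0 its last exponent is n - k * q = r - 1; for r = 0 the last arc has all n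
  vertices and weight 1.\<close>

lemma gap_weight_sum:
  assumes "2 \<le> k" "n + 1 = k * q + r" "r < k"
  shows "real (\<Sum>j=1..q. gap_weight (k * j - 1)) * (2 ^ k - 1)
    = (if r = 0 then 2 ^ n + 2 ^ (k - 1) - 1 else 2 ^ n - 2 ^ (r - 1))"
proof -
  have geo: "(\<Sum>j=1..l. 2 ^ (a + k * (l - j))) * (2 ^ k - 1) = (2 ^ (a + k * l) - 2 ^ a :: real)" for a l
  proof (induction l)
    case (Suc l)
    have "(\<Sum>j=1..Suc l. 2 ^ (a + k * (Suc l - j)) :: real)
        = (\<Sum>j=1..l. 2 ^ k * 2 ^ (a + k * (l - j))) + 2 ^ a"
      by (simp add: Suc_diff_le power_add mult_ac)
    also have "\<dots> = 2 ^ k * (\<Sum>j=1..l. 2 ^ (a + k * (l - j))) + 2 ^ a"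
      by (simp add: sum_distrib_left)
    finally show ?case using Suc by (simp add: power_add algebra_simps)
  qed simp
  have weight: "real (gap_weight (k * j - 1)) = 2 ^ (n - k * j)" if "1 \<le> j" "k * j \<le> n" for j
  proof -
    have "0 < k * j" using that assms by simp
    then show ?thesis using that unfolding gap_weight_def by (simp add: Suc_diff_Suc)
  qed
  show ?thesis
  proof (cases "r = 0")
    case False
    have "real (\<Sum>j=1..q. gap_weight (k * j - 1)) = (\<Sum>j=1..q. 2 ^ (r - 1 + k * (q - j)))"
      unfolding of_nat_sum
    proof (rule sum.cong[OF refl])
      fix j assume j: "j \<in> {1..q}"
      then have "k * j \<le> k * q" by (intro mult_le_mono2) simp
      then have "k * j \<le> n" "n - k * j = r - 1 + k * (q - j)"
        using assms(2) False unfolding diff_mult_distrib2 by linarith+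
      then show "real (gap_weight (k * j - 1)) = 2 ^ (r - 1 + k * (q - j))"
        using weight j by simp
    qed
    moreover have "n = r - 1 + k * q" using assms False by simp
    ultimately show ?thesis using geo[of "r - 1" q] False by simp
  next
    case True
    \<comment> \<open>The exceptional full arc j = q is split off; the remaining terms are geometric
      with smallest exponent n - k * l = k - 1.\<close>
    then obtain l where q: "q = Suc l" using assms by (cases q) auto
    have n: "n = k - 1 + k * l" using assms True q by simp
    have "real (\<Sum>j=1..l. gap_weight (k * j - 1)) = (\<Sum>j=1..l. 2 ^ (k - 1 + k * (l - j)))"
      unfolding of_nat_sum
    proof (rule sum.cong[OF refl])
      fix j assume j: "j \<in> {1..l}"
      then have "k * j \<le> k * l" by (intro mult_le_mono2) simp
      then have "k * j \<le> n" "n - k * j = k - 1 + k * (l - j)"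
        using n unfolding diff_mult_distrib2 by linarith+
      then show "real (gap_weight (k * j - 1)) = 2 ^ (k - 1 + k * (l - j))"
        using weight j by simp
    qed
    moreover have "gap_weight (k * q - 1) = 1"
      using assms True by (simp add: gap_weight_def flip: assms(2))
    ultimately have "real (\<Sum>j=1..q. gap_weight (k * j - 1)) * (2 ^ k - 1)
        = (2 ^ (k - 1 + k * l) - 2 ^ (k - 1)) + (2 ^ k - 1)"
      using geo[of "k - 1" l] by (simp add: q algebra_simps)
    moreover have "(2 :: real) ^ k = 2 * 2 ^ (k - 1)"
      using assms(1) by (metis Suc_diff_1 less_le_trans pos2 power_Suc)
    ultimately show ?thesis using True unfolding n[symmetric] by simp
  qed
qed

end

section \<open>Counting eigenvalues\<close>

text \<open>The angle is folded into [0, pi] and written as a multiple of pi/n, the form in which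
  \<open>cos_fraction_eq_iff\<close> applies.\<close>

lemma cos_cycle_reflect:
  assumes "j < n"
  shows "cos (2 * pi * real j / real n)
    = cos (real (if 2 * j \<le> n then 2 * j else 2 * (n - j)) * pi / real n)"
proof (cases "2 * j \<le> n")
  case False
  have "real (2 * (n - j)) * pi / real n = 2 * pi - 2 * pi * real j / real n"
    using assms by (simp add: of_nat_diff field_simps)
  then show ?thesis using False by (simp add: cos_diff)
qed (simp add: mult_ac)

lemma cos_cycle_eq_iff:
  assumes "j < n" "0 < k" "h \<le> k"
  shows "cos (2 * pi * real j / real n) = cos (real h * pi / real k)
    \<longleftrightarrow> 2 * j * k = h * n \<or> 2 * (n - j) * k = h * n"
proof -
  have le: "h * n \<le> k * n" using assms(3) by simp
  have A: "2 * j * k = h * n \<Longrightarrow> 2 * j \<le> n" "2 * (n - j) * k = h * n \<Longrightarrow> 2 * (n - j) \<le> n"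
    using le assms(2) by (metis mult.commute mult_le_cancel2)+
  show ?thesis
  proof (cases "2 * j \<le> n")
    case True
    have "2 * (n - j) * k = h * n \<Longrightarrow> 2 * j * k = h * n"
    proof -
      assume eq: "2 * (n - j) * k = h * n"
      have "n - j = j" using A(2)[OF eq] True assms(1) by linarith
      then show "2 * j * k = h * n" using eq by simp
    qed
    then show ?thesis
      using cos_cycle_reflect[OF assms(1)] True assms cos_fraction_eq_iff[of k h n "2 * j"] by auto
  next
    case False
    then show ?thesis
      using cos_cycle_reflect[OF assms(1)] assms A(1) cos_fraction_eq_iff[of k h n "2 * (n - j)"]
      by auto
  qed
qed

context circle
begin

text \<open>A solution of 2 * i * k = h * n forces k to divide n by coprimality, hence r = 1, n = k
  * q and 2 * i = h * q. If h * q = 2 * e, the solutions are e and n - e, distinct because h <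
  k.\<close>

lemma card_cycle_modes:
  assumes k: "2 \<le> k" and h: "1 \<le> h" "h < k" and cop: "coprime h k"
    and qr: "n + 1 = k * q + r" "r < k"
  shows "card {j. j < n \<and> cos (2 * pi * real j / real n) = cos (real h * pi / real k)}
    = (if r = 1 \<and> even (h * q) then 2 else 0)"
proof -
  let ?A = "{j. j < n \<and> cos (2 * pi * real j / real n) = cos (real h * pi / real k)}"
  have iff: "j \<in> ?A \<longleftrightarrow> j < n \<and> (2 * j * k = h * n \<or> 2 * (n - j) * k = h * n)" for j
    using cos_cycle_eq_iff[of j n k h] k h by auto
  have div: "r = 1 \<and> even (h * q)" if "2 * i * k = h * n" for i
  proof -
    have "k dvd h * n" unfolding that[symmetric] by simp
    then have "k dvd n" using cop by (simp add: coprime_commute coprime_dvd_mult_right_iff)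
    then have "(n + 1) mod k = 1" using k by (simp add: mod_Suc dvd_eq_mod_eq_0)
    then have r: "r = 1" using qr by simp
    then have "n = k * q" using qr by simp
    then have "2 * i = h * q" using that k by (metis mult.assoc mult.commute mult_cancel1 not_numeral_le_zero)
    then show ?thesis using r by (metis dvd_triv_left)
  qed
  show ?thesis
  proof (cases "r = 1 \<and> even (h * q)")
    case True
    then obtain e where e: "h * q = 2 * e" by (auto elim: evenE)
    have n: "n = k * q" using True qr by simp
    then have "0 < q" using n3 by (cases q) auto
    then have "0 < e" using e h by (metis gr0I less_le_trans mult_is_0 not_one_le_zero)
    have "2 * e < n" unfolding e[symmetric] n using h \<open>0 < q\<close> by simp
    have cancel: "2 * i * k = h * n \<longleftrightarrow> i = e" for i
    proof -
      have "h * n = 2 * e * k" unfolding n e[symmetric] by (simp add: mult_ac)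
      then show ?thesis using k by auto
    qed
    have "?A = {e, n - e}"
      using \<open>0 < e\<close> \<open>2 * e < n\<close> unfolding set_eq_iff iff cancel by auto
    moreover have "e \<noteq> n - e" using \<open>2 * e < n\<close> by auto
    ultimately show ?thesis using True by simp
  next
    case False
    then have "?A = {}" using div iff by blast
    then have "card ?A = 0" by (simp only: card.empty)
    then show ?thesis using False by (simp only: if_False)
  qed
qed

text \<open>Since h/k is in lowest terms, h'/(m + 1) = h/k means h' = h * j and m + 1 = k * j; the
  bound m \<le> n becomes j \<le> q.\<close>

lemma path_modes:
  assumes k: "2 \<le> k" and h: "1 \<le> h" "h < k" and cop: "coprime h k"
    and qr: "n + 1 = k * q + r" "r < k"
  shows "{(m, h'). (m, h') \<in> modes \<and> cos (real h' * pi / real (m + 1)) = cos (real h * pi / real k)}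
    = (\<lambda>j. (k * j - 1, h * j)) ` {1..q}" (is "?A = ?B")
proof (rule set_eqI, clarify)
  fix m h'
  have "(m, h') \<in> ?A \<longleftrightarrow> 1 \<le> h' \<and> h' \<le> m \<and> m \<le> n \<and> h' * k = h * (m + 1)"
    using cos_fraction_eq_iff[of k h "m + 1" h'] k h by (auto simp: modes_def)
  also have "\<dots> \<longleftrightarrow> (m, h') \<in> ?B"
  proof
    assume a: "1 \<le> h' \<and> h' \<le> m \<and> m \<le> n \<and> h' * k = h * (m + 1)"
    then have "k dvd h * (m + 1)" by (metis dvd_triv_right)
    then have "k dvd m + 1"
      using cop by (metis coprime_commute coprime_dvd_mult_right_iff)
    then obtain j where j: "m + 1 = k * j" by (auto elim: dvdE)
    have "h' * k = h * (k * j)" using a unfolding j[symmetric] by blast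
    then have "h' * k = (h * j) * k" by (simp only: mult_ac)
    then have "h' = h * j" using k by simp
    moreover have "1 \<le> j" using j by (cases j) auto
    moreover have "j \<le> q"
    proof (rule ccontr)
      assume "\<not> j \<le> q"
      then have "k * (q + 1) \<le> k * j" by (intro mult_le_mono2) simp
      then show False using a j qr by simp
    qed
    moreover have "m = k * j - 1" using j by simp
    ultimately show "(m, h') \<in> ?B" by auto
  next
    assume "(m, h') \<in> ?B"
    then obtain j where j: "1 \<le> j" "j \<le> q" "m = k * j - 1" "h' = h * j" by auto
    have "h * j < k * j" "k * j \<le> k * q" "0 < h * j" using h j by auto
    moreover from this have m: "m + 1 = k * j" using j by simp
    moreover have "h' * k = h * (m + 1)" unfolding m j(4) by (simp only: mult_ac)
    ultimately show "1 \<le> h' \<and> h' \<le> m \<and> m \<le> n \<and> h' * k = h * (m + 1)"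
      using j(4) qr by linarith
  qed
  finally show "(m, h') \<in> ?A \<longleftrightarrow> (m, h') \<in> ?B" .
qed

text \<open>Admitting k = 2 lets the same count serve for the eigenvalue 0.\<close>

lemma multiplicity_cos:
  assumes k: "2 \<le> k" and h: "1 \<le> h" "h < k" and cop: "coprime h k"
    and qr: "n + 1 = k * q + r" "r < k"
  shows "real (multiplicity_of (L (lamp_states n)) (markov_op n)
      (of_real (cos (real h * pi / real k))))
    = real n * ((if r = 0 then 2 ^ n + 2 ^ (k - 1) - 1 else 2 ^ n - 2 ^ (r - 1)) / (2 ^ k - 1))
      + (if r = 1 \<and> even (h * q) then 2 else 0)"
proof -
  have inj: "inj_on (\<lambda>j. (k * j - 1, h * j)) {1..q}"
    using h by (auto simp: inj_on_def)
  \<comment> \<open>This makes 2^k - 1 nonzero, so the geometric identity may be divided by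
    it.\<close>
  have "(2 :: real) ^ k \<ge> 2 ^ 2" using k by (intro power_increasing) auto
  then have "real (\<Sum>j=1..q. gap_weight (k * j - 1))
      = (if r = 0 then 2 ^ n + 2 ^ (k - 1) - 1 else 2 ^ n - 2 ^ (r - 1)) / (2 ^ k - 1)"
    unfolding gap_weight_sum[OF k qr, symmetric] by simp
  moreover have "(\<Sum>(m, h')\<in>(\<lambda>j. (k * j - 1, h * j)) ` {1..q}. gap_weight m)
      = (\<Sum>j=1..q. gap_weight (k * j - 1))"
    by (subst sum.reindex[OF inj]) (simp add: comp_def)
  ultimately show ?thesis
    unfolding multiplicity_eq card_cycle_modes[OF assms] path_modes[OF assms]
    by (simp only: of_nat_add of_nat_mult) simp
qed

section \<open>The eigenvalues 1 and -1, the full set of eigenvalues, and the multiplicity of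
  0\<close>

lemma not_path_eigenvalue:
  assumes "(m, h) \<in> modes"
  shows "cos (real h * pi / real (m + 1)) \<noteq> 1" "cos (real h * pi / real (m + 1)) \<noteq> - 1"
  using assms cos_fraction_eq_iff[of 1 0 "m + 1" h] cos_fraction_eq_iff[of 1 1 "m + 1" h]
  by (auto simp: modes_def)

lemma cycle_eigenvalue_iff:
  assumes "j < n"
  shows "cos (2 * pi * real j / real n) = 1 \<longleftrightarrow> j = 0"
    and "cos (2 * pi * real j / real n) = - 1 \<longleftrightarrow> 2 * j = n"
  using cos_cycle_eq_iff[OF assms, of 1 0] cos_cycle_eq_iff[OF assms, of 1 1] assms by auto

lemma multiplicity_one:
  "multiplicity_of (L (lamp_states n)) (markov_op n) 1 = 1"
proof -
  have A: "{j. j < n \<and> cos (2 * pi * real j / real n) = 1} = {0}"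
    using cycle_eigenvalue_iff n3 by auto
  have B: "{(m, h). (m, h) \<in> modes \<and> cos (real h * pi / real (m + 1)) = 1} = {}"
    using not_path_eigenvalue by auto
  show ?thesis using multiplicity_eq[of 1, unfolded A B] by simp
qed

lemma multiplicity_minus_one:
  "multiplicity_of (L (lamp_states n)) (markov_op n) (- 1) = (if even n then 1 else 0)"
proof -
  have A: "{j. j < n \<and> cos (2 * pi * real j / real n) = - 1} = (if even n then {n div 2} else {})"
    using cycle_eigenvalue_iff n3 by auto
  have B: "{(m, h). (m, h) \<in> modes \<and> cos (real h * pi / real (m + 1)) = - 1} = {}"
    using not_path_eigenvalue by auto
  show ?thesis using multiplicity_eq[of "- 1", unfolded A B] by simp
qed

text \<open>Apart from 1 and -1, the circle contributes nothing new: folding its angles gives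
  fractions with denominator n, already among those of the paths. Conversely every fraction with
  denominator at most n + 1 occurs, because each path length has positive weight.\<close>

lemma eigenvalues_unreduced:
  "evalue ` index = {1} \<union> (if even n then {- 1} else {})
    \<union> {cos (real h * pi / real k) | h k. 1 \<le> h \<and> h < k \<and> k \<le> n + 1}" (is "_ = _ \<union> ?C")
proof (intro equalityI subsetI)
  fix c assume "c \<in> evalue ` index"
  then obtain i where i: "i \<in> index" "c = evalue i" by blast
  show "c \<in> {1} \<union> (if even n then {- 1} else {}) \<union> ?C"
  proof (cases i rule: efun.cases)
    case (1 j)
    then have j: "j < n" using i by (auto simp: index_def)
    consider "j = 0" | "2 * j = n" | "0 < j" "2 * j < n" | "n < 2 * j" by linarith
    then show ?thesis
    proof cases
      case 3
      then have "c = cos (real (2 * j) * pi / real n)"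
        using cos_cycle_reflect[OF j] i 1 by simp
      moreover have "1 \<le> 2 * j" "n \<le> n + 1" using 3 by auto
      ultimately show ?thesis using 3 by blast
    next
      case 4
      then have "c = cos (real (2 * (n - j)) * pi / real n)"
        using cos_cycle_reflect[OF j] i 1 by simp
      moreover have "1 \<le> 2 * (n - j)" "2 * (n - j) < n" "n \<le> n + 1" using 4 j by auto
      ultimately show ?thesis by blast
    qed (use i 1 j cycle_eigenvalue_iff[OF j] in auto)
  next
    case (2 m h p \<theta>)
    then have "1 \<le> h" "h < m + 1" "m + 1 \<le> n + 1"
      using i by (auto simp: index_def modes_def)
    then have "c \<in> ?C" unfolding i(2) 2 evalue.simps by blast
    then show ?thesis by blast
  qed
next
  fix c assume c: "c \<in> {1} \<union> (if even n then {- 1} else {}) \<union> ?C"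
  have Inl: "cos (2 * pi * real j / real n) \<in> evalue ` index" if "j < n" for j
    using that by (intro image_eqI[of _ _ "Inl j"]) (auto simp: index_def)
  consider "c = 1" | "c = - 1" "even n" | "c \<in> ?C" using c by (auto split: if_splits)
  then show "c \<in> evalue ` index"
  proof cases
    case 1
    then show ?thesis using Inl[of 0] n3 by simp
  next
    case 2
    then show ?thesis using Inl[of "n div 2"] n3 cycle_eigenvalue_iff(2)[of "n div 2"] by simp
  next
    case 3
    then obtain h k where hk: "c = cos (real h * pi / real k)" "1 \<le> h" "h < k" "k \<le> n + 1"
      by blast
    define m where "m = k - 1"
    have m: "k = m + 1" "1 \<le> m" "m \<le> n" using hk by (auto simp: m_def)
    have "card (components m) \<noteq> 0"
      using card_components[OF m(2,3)] n3 by (simp add: gap_weight_def)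
    then have "components m \<noteq> {}" by auto
    then obtain p \<theta> where "(p, \<theta>) \<in> components m" by fast
    then have "Inr ((m, h), (p, \<theta>)) \<in> index"
      using hk m by (auto simp: index_def modes_def)
    then show ?thesis
      using hk m by (intro image_eqI[of _ _ "Inr ((m, h), (p, \<theta>))"]) auto
  qed
qed

text \<open>Cancelling the gcd only lowers the denominator. Denominator 2 leaves the single fraction
  1/2, whose cosine is the separately listed 0.\<close>

lemma reduced_fractions:
  "{cos (real h * pi / real k) | h k. 1 \<le> h \<and> h < k \<and> k \<le> n + 1}
    = {0} \<union> {cos (real h * pi / real k) | h k.
        3 \<le> k \<and> k \<le> n + 1 \<and> 1 \<le> h \<and> h \<le> k - 1 \<and> gcd h k = 1}" (is "?A = _ \<union> ?B")
proof (intro equalityI Un_least subsetI)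
  fix c assume "c \<in> ?A"
  then obtain h k where hk: "c = cos (real h * pi / real k)" "1 \<le> h" "h < k" "k \<le> n + 1"
    by blast
  obtain h' k' where red: "h = h' * gcd h k" "k = k' * gcd h k" "coprime h' k'"
    using gcd_coprime_exists[of h k] hk by auto
  have g: "0 < gcd h k" using hk by simp
  have "1 \<le> h'" using red hk by (cases h') auto
  moreover have "h' < k'" using red hk g by (metis mult_less_cancel2)
  moreover have "k' \<le> k" using red(2) g by (metis Suc_leI mult.right_neutral mult_le_mono2 One_nat_def)
  moreover have "c = cos (real h' * pi / real k')"
  proof -
    have "h * k' = h' * k" using red by (metis mult.assoc mult.commute)
    then show ?thesis using hk \<open>h' < k'\<close> cos_fraction_eq_iff[of k' h' k h] by simp
  qed
  ultimately have c: "1 \<le> h'" "h' \<le> k' - 1" "h' < k'" "k' \<le> n + 1" "c = cos (real h' * pi / real k')" "gcd h' k' = 1"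
    using hk red(3) by auto
  show "c \<in> {0} \<union> ?B"
  proof (cases "3 \<le> k'")
    case True
    then have "c \<in> ?B" using c by (intro CollectI exI[of _ h'] exI[of _ k']) simp
    then show ?thesis by blast
  next
    case False
    then have k': "k' = 2" and h': "h' = 1" using c by auto
    have "c = 0" unfolding c(5) k' h' by simp
    then show ?thesis by blast
  qed
next
  fix c :: real assume "c \<in> {0}"
  then show "c \<in> ?A"
    by (intro CollectI exI[of _ "1::nat"] exI[of _ "2::nat"]) (use n3 in simp)
next
  fix c assume "c \<in> ?B"
  then obtain h k where "c = cos (real h * pi / real k)" "3 \<le> k" "k \<le> n + 1" "1 \<le> h" "h \<le> k - 1"
    by blast
  then show "c \<in> ?A"
    by (intro CollectI exI[of _ h] exI[of _ k]) simp
qed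

lemma eigenvalues_markov_op:
  "eigenvalues (L (lamp_states n)) (markov_op n) = {1} \<union> {0} \<union> (if even n then {- 1} else {})
    \<union> {of_real (cos (real h * pi / real k)) | h k.
        3 \<le> k \<and> k \<le> n + 1 \<and> 1 \<le> h \<and> h \<le> k - 1 \<and> gcd h k = 1}"
proof -
  have "eigenvalues (L (lamp_states n)) (markov_op n) = of_real ` evalue ` index"
    by (simp add: markov_op_spectrum image_image)
  also have "\<dots> = of_real ` ({1} \<union> {0} \<union> (if even n then {- 1} else {})
    \<union> {cos (real h * pi / real k) | h k.
        3 \<le> k \<and> k \<le> n + 1 \<and> 1 \<le> h \<and> h \<le> k - 1 \<and> gcd h k = 1})"
    unfolding eigenvalues_unreduced reduced_fractions by (intro arg_cong[of _ _ "image _"]) blast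
  also have "\<dots> = {1} \<union> {0} \<union> (if even n then {- 1} else {})
    \<union> {of_real (cos (real h * pi / real k)) | h k.
        3 \<le> k \<and> k \<le> n + 1 \<and> 1 \<le> h \<and> h \<le> k - 1 \<and> gcd h k = 1}"
    by (auto simp: image_Un)
  finally show ?thesis .
qed

text \<open>For h = 1, k = 2 the denominator is 2^2 - 1 = 3. Odd n gives r = 0; even n gives r = 1
  and q = n/2, and the circle adds 2 exactly when q is even, that is, when 4 divides n.\<close>

lemma multiplicity_zero:
  "real (multiplicity_of (L (lamp_states n)) (markov_op n) 0)
    = (if odd n then real n / 3 * 2 ^ n + real n / 3
       else real n / 3 * 2 ^ n - real n / 3 + (if n mod 4 = 0 then 2 else 0))"
proof -
  have z: "of_real (cos (real 1 * pi / real 2)) = (0 :: complex)" by simp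
  show ?thesis
  proof (cases "odd n")
    case True
    then have "n + 1 = 2 * ((n + 1) div 2) + 0" by simp
    from multiplicity_cos[of 2 1 _ 0, unfolded z, OF _ _ _ _ this] True
    show ?thesis by (simp add: field_simps)
  next
    case False
    then obtain q where q: "n = 2 * q" by (auto elim!: evenE)
    then have "n + 1 = 2 * q + 1" by simp
    from multiplicity_cos[of 2 1 q 1, unfolded z, OF _ _ _ _ this]
    have "real (multiplicity_of (L (lamp_states n)) (markov_op n) 0)
        = real n * ((2 ^ n - 1) / 3) + (if even q then 2 else 0)" by simp
    moreover have "even q \<longleftrightarrow> n mod 4 = 0" unfolding q by presburger
    ultimately show ?thesis using False by (simp add: field_simps)
  qed
qed

end

theorem theorem6p1:
  fixes n :: nat
  assumes "n \<ge> 3"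
  shows
    "cfun.dim (L (lamp_states n)) = n * 2 ^ n
     \<and> (odd n \<longrightarrow>
          eigenvalues (L (lamp_states n)) (markov_op n) =
            {1} \<union> {0} \<union>
            {complex_of_real (cos (real h * pi / real k)) | h k :: nat.
               3 \<le> k \<and> k \<le> n + 1 \<and> 1 \<le> h \<and> h \<le> k - 1 \<and> gcd h k = 1})
     \<and> (even n \<longrightarrow>
          eigenvalues (L (lamp_states n)) (markov_op n) =
            {1} \<union> {0} \<union> {-1} \<union>
            {complex_of_real (cos (real h * pi / real k)) | h k :: nat.
               3 \<le> k \<and> k \<le> n + 1 \<and> 1 \<le> h \<and> h \<le> k - 1 \<and> gcd h k = 1})
     \<and> (\<forall>h k q r :: nat.
          3 \<le> k \<and> k \<le> n + 1 \<and> 1 \<le> h \<and> h \<le> k - 1 \<and> gcd h k = 1 \<and>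
          n + 1 = k * q + r \<and> r \<le> k - 1 \<longrightarrow>
          (let m = real (multiplicity_of (L (lamp_states n)) (markov_op n)
                           (complex_of_real (cos (real h * pi / real k))))
           in (r \<noteq> 0 \<and> r \<noteq> 1 \<longrightarrow> m = real n * ((2 ^ n - 2 ^ (r - 1)) / (2 ^ k - 1)))
            \<and> (r = 1 \<and> odd (h * q) \<longrightarrow> m = real n * ((2 ^ n - 1) / (2 ^ k - 1)))
            \<and> (r = 1 \<and> even (h * q) \<longrightarrow> m = real n * ((2 ^ n - 1) / (2 ^ k - 1)) + 2)
            \<and> (r = 0 \<longrightarrow> m = real n * ((2 ^ n + 2 ^ (k - 1) - 1) / (2 ^ k - 1)))))
     \<and> multiplicity_of (L (lamp_states n)) (markov_op n) 1 = 1
     \<and> multiplicity_of (L (lamp_states n)) (markov_op n) (-1) = (if even n then 1 else 0)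
     \<and> (let m = real (multiplicity_of (L (lamp_states n)) (markov_op n) 0)
        in (odd n \<longrightarrow> m = real n / 3 * 2 ^ n + real n / 3)
         \<and> (n mod 4 = 2 \<longrightarrow> m = real n / 3 * 2 ^ n - real n / 3)
         \<and> (n mod 4 = 0 \<longrightarrow> m = real n / 3 * 2 ^ n - real n / 3 + 2))"
proof -
  interpret circle n by unfold_locales (rule assms)
  show ?thesis
  proof (intro conjI allI impI)
    show "cfun.dim (L (lamp_states n)) = n * 2 ^ n"
      by (simp add: dim_L finite_lamp_states card_lamp_states)
  next
    fix h k q r :: nat
    assume a: "3 \<le> k \<and> k \<le> n + 1 \<and> 1 \<le> h \<and> h \<le> k - 1 \<and> gcd h k = 1 \<and>
      n + 1 = k * q + r \<and> r \<le> k - 1"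
    then have "2 \<le> k" "1 \<le> h" "h < k" "coprime h k" "n + 1 = k * q + r" "r < k"
      by (auto simp: coprime_iff_gcd_eq_1)
    from multiplicity_cos[OF this]
    show "let m = real (multiplicity_of (L (lamp_states n)) (markov_op n)
                           (complex_of_real (cos (real h * pi / real k))))
           in (r \<noteq> 0 \<and> r \<noteq> 1 \<longrightarrow> m = real n * ((2 ^ n - 2 ^ (r - 1)) / (2 ^ k - 1)))
            \<and> (r = 1 \<and> odd (h * q) \<longrightarrow> m = real n * ((2 ^ n - 1) / (2 ^ k - 1)))
            \<and> (r = 1 \<and> even (h * q) \<longrightarrow> m = real n * ((2 ^ n - 1) / (2 ^ k - 1)) + 2)
            \<and> (r = 0 \<longrightarrow> m = real n * ((2 ^ n + 2 ^ (k - 1) - 1) / (2 ^ k - 1)))"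
      unfolding Let_def by auto
  next
    show "let m = real (multiplicity_of (L (lamp_states n)) (markov_op n) 0)
        in (odd n \<longrightarrow> m = real n / 3 * 2 ^ n + real n / 3)
         \<and> (n mod 4 = 2 \<longrightarrow> m = real n / 3 * 2 ^ n - real n / 3)
         \<and> (n mod 4 = 0 \<longrightarrow> m = real n / 3 * 2 ^ n - real n / 3 + 2)"
    proof -
      have "n mod 4 = 2 \<Longrightarrow> even n" "n mod 4 = 0 \<Longrightarrow> even n" by presburger+
      then show ?thesis unfolding Let_def multiplicity_zero by auto
    qed
  qed (simp_all add: eigenvalues_markov_op multiplicity_one multiplicity_minus_one)
qed

end
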